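(* Let $f\colon S^1\to\mathbb{R}$ be a function and let $C\in\mathbb{R}$. Consider the following two conditions: (A) $f(x)+f(-x)=\pi\cdot C$ for all $x\in S^1$; (B) $f$ is Lipschitz continuous and left-differentiable, and the total variation $\|\partial_- f\|_{\mathrm{TV}(S^1)}$ of its left derivative $\partial_- f\colon S^1\to\mathbb{R}$ is finite. Then conditions (A) and (B) both hold if and only if there exists a unique signed Borel measure $\lambda$ on $S^1$ with $T_\#\lambda=-\lambda$ such that $f$ is representable by $\bar\lambda=\lambda+C\cdot\mathscr{H}^1$, i.e. \[ f(x)=\int_{S^1} d_{S^1}(x,y)\,\bar\lambda(\mathrm{d}y)\qquad\text{for all } x\in S^1 . \]
   Context: $S^1\subset\mathbb{R}^2$ is the unit circle with the spherical distance $d_{S^1}(x,y)=\arccos(\langle x,y\rangle)$ (the length of the shorter arc between $x$ and $y$). $\mathscr{H}^1$ denotes the normalized Hausdorff $1$-measure on $S^1$, so $\mathscr{H}^1(S^1)=1$. A signed (Borel) measure on $S^1$ is a countably additive function $\lambda\colon\mathcal{B}(S^1)\to\mathbb{R}$ (finite real values) with $\lambda(\emptyset)=0$. $T\colon S^1\to S^1$ is the antipodal map $T(x)=-x$, and $T_\#\lambda$ denotes the push-forward of $\lambda$ under $T$. Let $q\colon\mathbb{R}\to S^1$, $q(t)=(\cos t,\sin t)$, and for $x\in S^1$, $t\in\mathbb{R}$ set $x+_q t=q(a+t)$ for any $a\in q^{-1}(x)$. A function $f\colon S^1\to\mathbb{R}$ is left-differentiable if the limit $\partial_- f(x)=\lim_{t\to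 0^-}\frac{f(x+_q t)-f(x)}{t}$ exists (in $\mathbb{R}$) for every $x\in S^1$. Lipschitz continuity is with respect to $d_{S^1}$. The total variation of a function $g\colon S^1\to\mathbb{R}$ is $\|g\|_{\mathrm{TV}(S^1)}=\sup\sum_{i=0}^{n}|g(x_i)-g(x_{i+1})|$, where the supremum is over all partitions $\{x_0,\dots,x_{n+1}\}$ of $S^1$, meaning $x_i=q(t_i)$ for some partition $0=t_0\le t_1\le\dots\le t_{n+1}=2\pi$ of $[0,2\pi]$. *)

theory Defs
  imports "HOL-Analysis.Analysis"
begin

section \<open>The unit circle\<close>

definition unit_circle :: "(real \<times> real) set" where
  "unit_circle = sphere 0 1"

definition circle_dist :: "real \<times> real \<Rightarrow> real \<times> real \<Rightarrow> real" where
  "circle_dist x y = arccos (x \<bullet> y)"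

definition circle_param :: "real \<Rightarrow> real \<times> real" where
  "circle_param t = (cos t, sin t)"

text \<open>For \<open>x\<close> on the circle the result does not depend on the chosen preimage of \<open>x\<close>.\<close>

definition circle_shift :: "real \<times> real \<Rightarrow> real \<Rightarrow> real \<times> real" where
  "circle_shift x t = circle_param ((SOME a. circle_param a = x) + t)"

text \<open>Only the space and the sigma-algebra of \<open>circle_borel\<close> are relevant.\<close>

definition circle_borel :: "(real \<times> real) measure" where
  "circle_borel = restrict_space borel unit_circle"


section \<open>Functions on the circle\<close>

text \<open>
  Functions on the circle are total functions on the plane, of which only the values on
  \<^const>\<open>unit_circle\<close> are used.
\<close>

definition circle_lipschitz :: "(real \<times> real \<Rightarrow> real) \<Rightarrow> bool" where
  "circle_lipschitz f \<longleftrightarrow>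
     (\<exists>L\<ge>0. \<forall>x\<in>unit_circle. \<forall>y\<in>unit_circle. \<bar>f x - f y\<bar> \<le> L * circle_dist x y)"

definition left_differentiable :: "(real \<times> real \<Rightarrow> real) \<Rightarrow> bool" where
  "left_differentiable f \<longleftrightarrow>
     (\<forall>x\<in>unit_circle. \<exists>D. ((\<lambda>t. (f (circle_shift x t) - f x) / t) \<longlongrightarrow> D) (at_left 0))"

definition left_derivative :: "(real \<times> real \<Rightarrow> real) \<Rightarrow> real \<times> real \<Rightarrow> real" where
  "left_derivative f x = Lim (at_left 0) (\<lambda>t. (f (circle_shift x t) - f x) / t)"

definition circle_total_variation :: "(real \<times> real \<Rightarrow> real) \<Rightarrow> ennreal" where
  "circle_total_variation g =
     (SUP (n, t) \<in> {(n :: nat, t :: nat \<Rightarrow> real).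
                      t 0 = 0 \<and> t (Suc n) = 2 * pi \<and> (\<forall>i\<le>n. t i \<le> t (Suc i))}.
        ennreal (\<Sum>i=0..n. \<bar>g (circle_param (t i)) - g (circle_param (t (Suc i)))\<bar>))"


section \<open>Normalized Hausdorff measure\<close>

text \<open>The Hausdorff measure is that of the circle as a metric space under \<^const>\<open>circle_dist\<close>.\<close>

definition circle_diameter :: "(real \<times> real) set \<Rightarrow> ennreal" where
  "circle_diameter U = (SUP (x, y) \<in> U \<times> U. ennreal (circle_dist x y))"

definition hausdorff1_pre :: "real \<Rightarrow> (real \<times> real) set \<Rightarrow> ennreal" where
  "hausdorff1_pre \<delta> A =
     (INF U \<in> {U :: nat \<Rightarrow> (real \<times> real) set.
                (\<forall>i. U i \<subseteq> unit_circle \<and> circle_diameter (U i) \<le> ennreal \<delta>) \<and> A \<subseteq> (\<Union>i. U i)}.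
        \<Sum>i. circle_diameter (U i))"

definition hausdorff1 :: "(real \<times> real) set \<Rightarrow> ennreal" where
  "hausdorff1 A = (SUP \<delta> \<in> {0<..}. hausdorff1_pre \<delta> A)"

definition normalized_hausdorff1 :: "(real \<times> real) set \<Rightarrow> real" where
  "normalized_hausdorff1 A = enn2real (hausdorff1 A / hausdorff1 unit_circle)"


section \<open>Signed measures\<close>

text \<open>
  A signed measure is a function on the sigma-algebra of \<open>M\<close>. Membership in
  \<^term>\<open>sets M \<rightarrow>\<^sub>E UNIV\<close> fixes the irrelevant values at non-measurable sets, so that equality
  of signed measures is equality of functions on the sigma-algebra.
\<close>

definition signed_measure :: "'a measure \<Rightarrow> ('a set \<Rightarrow> real) \<Rightarrow> bool" where
  "signed_measure M \<nu> \<longleftrightarrow>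
     \<nu> \<in> sets M \<rightarrow>\<^sub>E UNIV \<and> \<nu> {} = 0 \<and>
     (\<forall>A :: nat \<Rightarrow> 'a set. range A \<subseteq> sets M \<longrightarrow> disjoint_family A \<longrightarrow>
        (\<lambda>i. \<nu> (A i)) sums \<nu> (\<Union>i. A i))"

definition signed_distr ::
  "'a measure \<Rightarrow> 'b measure \<Rightarrow> ('a \<Rightarrow> 'b) \<Rightarrow> ('a set \<Rightarrow> real) \<Rightarrow> 'b set \<Rightarrow> real" where
  "signed_distr M N T \<nu> = (\<lambda>A\<in>sets N. \<nu> (T -` A \<inter> space M))"

text \<open>
  The upper variation is the positive part of the Jordan decomposition; the negative part of
  \<open>\<nu>\<close> is the upper variation of \<open>-\<nu>\<close>. Negative values are sent to \<open>0\<close> by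
  \<^const>\<open>ennreal\<close>, which does not affect the supremum since \<open>\<nu> {} = 0\<close>.
\<close>

definition upper_variation :: "'a measure \<Rightarrow> ('a set \<Rightarrow> real) \<Rightarrow> 'a measure" where
  "upper_variation M \<nu> =
     measure_of (space M) (sets M) (\<lambda>A. SUP B \<in> {B \<in> sets M. B \<subseteq> A}. ennreal (\<nu> B))"

definition signed_integral :: "'a measure \<Rightarrow> ('a set \<Rightarrow> real) \<Rightarrow> ('a \<Rightarrow> real) \<Rightarrow> real" where
  "signed_integral M \<nu> g =
     (LINT y|upper_variation M \<nu>. g y) - (LINT y|upper_variation M (\<lambda>A. - \<nu> A). g y)"

end

theory Submission
  imports Defs
begin

text \<open>
  The integral \<open>F x = (LINT y. circle_dist x y)\<close> against a signed measure \<open>\<kappa>\<close> is called the potential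
  of \<open>\<kappa>\<close> below. Everything rests on one computation: moving \<open>x\<close> clockwise brings it closer to the points
  of the half circle that ends at \<open>x\<close> and takes it away from the points of the half circle that starts at
  \<open>x\<close>, in both cases with unit speed. By dominated convergence the left derivative of the potential at
  \<open>circle_param a\<close> is therefore the mass of the half-open half circle before \<open>a\<close> minus the mass of the one
  after \<open>a\<close>, that is \<open>\<kappa>(S) - 2 \<kappa>[a, a + \<pi>)\<close> (\<open>potential_regularity\<close>). For
  \<open>\<kappa> = \<nu> + C \<H>\<close> with \<open>\<nu>\<close> antisymmetric under the antipodal map and \<open>\<H>\<close> the normalized
  Hausdorff measure, this is \<open>-2 \<nu>[a, a + \<pi>)\<close> (\<open>antisymmetric_potential\<close>).

  From a representing measure to the two conditions: condition (A) is the identity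
  \<open>circle_dist x y + circle_dist (- x) y = \<pi>\<close> integrated against a measure of total mass \<open>C\<close>; the Lipschitz bound
  and the finite variation of the left derivative follow from the formula for the derivative, because two
  half circles differ by two short arcs.

  Uniqueness: by the formula, \<open>f\<close> determines \<open>\<nu>\<close> on all half circles. Two half circles that start at \<open>s\<close>
  and \<open>t\<close> differ by the arc \<open>[s, t)\<close> and its antipode, whose masses are opposite, so the masses of arcs are
  determined, and arcs generate the Borel sets (\<open>representing_measure_unique\<close>).

  Existence: let \<open>h\<close> be the left derivative of \<open>f\<close>, as a function of the angle. It has bounded variation and
  it is left-continuous, since a left derivative that has a left limit agrees with it
  (\<open>left_derivative_eq_left_limit\<close>). Hence \<open>h / 4\<close> is the distribution function of a signed Stieltjes measure
  on \<open>[0, \<pi>)\<close>. Extended antisymmetrically to the circle, it gives the half circles the masses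
  \<open>- h / 2\<close>, because \<open>h (t + \<pi>) = - h t\<close> (\<open>antisymmetric_measure_exists\<close>). So its potential has the same left
  derivative as \<open>f\<close>. A continuous function with left derivative zero is constant, and condition (A),
  which holds for both functions, makes the constant difference vanish (\<open>representing_measure_exists\<close>).

  Two facts about measures are needed on the way: the Jordan decomposition of a real-valued
  \<open>\<sigma>\<close>-additive set function (\<open>Jordan_decomposition\<close>), and the identification of the Hausdorff measure on
  Borel sets with the Lebesgue measure of the set of angles (\<open>hausdorff1_eq\<close>), which shows that
  it is \<open>\<sigma>\<close>-additive.
\<close>

section \<open>Real-valued \<open>\<sigma>\<close>-additive set functions\<close>

text \<open>
  The condition \<^const>\<open>signed_measure\<close> without extensionality. Sums such as \<open>\<nu> + C \<H>\<close> are not extensional,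
  and the potential depends on the values at Borel sets only.
\<close>

definition sigma_additive :: "'a measure \<Rightarrow> ('a set \<Rightarrow> real) \<Rightarrow> bool" where
  "sigma_additive M \<nu> \<longleftrightarrow> \<nu> {} = 0 \<and>
     (\<forall>A :: nat \<Rightarrow> 'a set. range A \<subseteq> sets M \<longrightarrow> disjoint_family A \<longrightarrow>
        (\<lambda>i. \<nu> (A i)) sums \<nu> (\<Union>i. A i))"

lemma signed_measure_iff: "signed_measure M \<nu> \<longleftrightarrow> \<nu> \<in> sets M \<rightarrow>\<^sub>E UNIV \<and> sigma_additive M \<nu>"
  by (simp add: signed_measure_def sigma_additive_def)

lemma sigma_additive_empty: "sigma_additive M \<nu> \<Longrightarrow> \<nu> {} = 0"
  by (simp add: sigma_additive_def)

lemma sigma_additive_sums: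
  fixes A :: "nat \<Rightarrow> 'a set"
  assumes "sigma_additive M \<nu>" "range A \<subseteq> sets M" "disjoint_family A"
  shows "(\<lambda>i. \<nu> (A i)) sums \<nu> (\<Union>i. A i)"
  using assms by (simp add: sigma_additive_def)

lemma sigma_additive_Un:
  assumes "sigma_additive M \<nu>" "A \<in> sets M" "B \<in> sets M" "A \<inter> B = {}"
  shows "\<nu> (A \<union> B) = \<nu> A + \<nu> B"
proof -
  have "(\<lambda>i. \<nu> (binaryset A B i)) sums \<nu> (\<Union>i. binaryset A B i)"
    using assms by (intro sigma_additive_sums[where M=M])
      (auto simp: range_binaryset_eq disjoint_family_on_def binaryset_def)
  moreover have "(\<lambda>i. \<nu> (binaryset A B i)) sums (\<nu> A + \<nu> B)"
    using sigma_additive_empty[OF assms(1)] by (intro binaryset_sums) auto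
  ultimately show ?thesis
    by (simp add: UN_binaryset_eq sums_unique2)
qed

lemma sigma_additive_Diff:
  assumes "sigma_additive M \<nu>" "A \<in> sets M" "B \<in> sets M" "B \<subseteq> A"
  shows "\<nu> (A - B) = \<nu> A - \<nu> B"
proof -
  have "B \<union> (A - B) = A" using assms(4) by blast
  then show ?thesis
    using sigma_additive_Un[OF assms(1,3), of "A - B"] assms by auto
qed

lemma sigma_additive_uminus:
  assumes "sigma_additive M \<nu>" shows "sigma_additive M (\<lambda>A. - \<nu> A)"
  using assms by (auto simp: sigma_additive_def intro: sums_minus)

lemma sigma_additive_add:
  assumes "sigma_additive M \<nu>" "sigma_additive M \<mu>" shows "sigma_additive M (\<lambda>A. \<nu> A + \<mu> A)"
  using assms by (auto simp: sigma_additive_def intro: sums_add)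

lemma sigma_additive_diff:
  assumes "sigma_additive M \<nu>" "sigma_additive M \<mu>" shows "sigma_additive M (\<lambda>A. \<nu> A - \<mu> A)"
  using assms by (auto simp: sigma_additive_def intro: sums_diff)

lemma sigma_additive_cmult:
  assumes "sigma_additive M \<nu>" shows "sigma_additive M (\<lambda>A. c * \<nu> A)"
  using assms by (auto simp: sigma_additive_def intro: sums_mult)

lemma sigma_additive_cong:
  assumes "sigma_additive M \<nu>" "\<And>A. A \<in> sets M \<Longrightarrow> \<mu> A = \<nu> A" shows "sigma_additive M \<mu>"
proof -
  have "(\<lambda>i. \<mu> (A i)) sums \<mu> (\<Union>i. A i)"
    if "range A \<subseteq> sets M" "disjoint_family A" for A :: "nat \<Rightarrow> 'a set"
  proof -
    have "(\<Union>i. A i) \<in> sets M" "\<And>i. A i \<in> sets M" using that by auto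
    then show ?thesis using sigma_additive_sums[OF assms(1) that] assms(2) by simp
  qed
  then show ?thesis using assms sigma_additive_empty[OF assms(1)] by (simp add: sigma_additive_def)
qed

lemma sigma_additive_vimage:
  assumes "sigma_additive M \<nu>" "T \<in> measurable M N"
  shows "sigma_additive N (\<lambda>A. \<nu> (T -` A \<inter> space M))"
proof -
  have "(\<lambda>i. \<nu> (T -` A i \<inter> space M)) sums \<nu> (T -` (\<Union>i. A i) \<inter> space M)"
    if "range A \<subseteq> sets N" "disjoint_family A" for A :: "nat \<Rightarrow> 'b set"
  proof -
    have "(\<lambda>i. \<nu> (T -` A i \<inter> space M)) sums \<nu> (\<Union>i. T -` A i \<inter> space M)"
      using that assms by (intro sigma_additive_sums[OF assms(1)])
        (auto simp: disjoint_family_on_def intro!: measurable_sets)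
    also have "(\<Union>i. T -` A i \<inter> space M) = T -` (\<Union>i. A i) \<inter> space M" by auto
    finally show ?thesis .
  qed
  then show ?thesis using sigma_additive_empty[OF assms(1)] by (simp add: sigma_additive_def)
qed

lemma sigma_additive_measure_vimage:
  assumes "finite_measure N" "T \<in> measurable N M"
  shows "sigma_additive M (\<lambda>A. measure N (T -` A \<inter> space N))"
proof -
  interpret finite_measure N by fact
  have "(\<lambda>i. measure N (T -` A i \<inter> space N)) sums measure N (T -` (\<Union>i. A i) \<inter> space N)"
    if "range A \<subseteq> sets M" "disjoint_family A" for A :: "nat \<Rightarrow> _ set"
  proof -
    have "(\<lambda>i. measure N (T -` A i \<inter> space N)) sums measure N (\<Union>i. T -` A i \<inter> space N)"
      using that assms by (intro finite_measure_UNION)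
        (auto simp: disjoint_family_on_def intro!: measurable_sets)
    also have "(\<Union>i. T -` A i \<inter> space N) = T -` (\<Union>i. A i) \<inter> space N" by auto
    finally show ?thesis .
  qed
  then show ?thesis by (simp add: sigma_additive_def)
qed

section \<open>The Jordan decomposition\<close>

definition upper_sup :: "'a measure \<Rightarrow> ('a set \<Rightarrow> real) \<Rightarrow> 'a set \<Rightarrow> ennreal" where
  "upper_sup M \<nu> A = (SUP B \<in> {B \<in> sets M. B \<subseteq> A}. ennreal (\<nu> B))"

lemma upper_sup_upper: "B \<in> sets M \<Longrightarrow> B \<subseteq> A \<Longrightarrow> ennreal (\<nu> B) \<le> upper_sup M \<nu> A"
  unfolding upper_sup_def by (intro SUP_upper) auto

lemma upper_sup_mono: "A \<subseteq> A' \<Longrightarrow> upper_sup M \<nu> A \<le> upper_sup M \<nu> A'"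
  unfolding upper_sup_def by (intro SUP_subset_mono) auto

lemma upper_sup_empty: "sigma_additive M \<nu> \<Longrightarrow> upper_sup M \<nu> {} = 0"
proof -
  assume "sigma_additive M \<nu>"
  moreover have "{B \<in> sets M. B \<subseteq> {}} = {{}}" by auto
  ultimately show ?thesis by (simp add: upper_sup_def sigma_additive_empty)
qed

lemma upper_sup_super:
  assumes \<nu>: "sigma_additive M \<nu>" and "A \<inter> A' = {}"
  shows "upper_sup M \<nu> A + upper_sup M \<nu> A' \<le> upper_sup M \<nu> (A \<union> A')"
proof -
  have *: "ennreal (\<nu> B) + ennreal (\<nu> B') \<le> upper_sup M \<nu> (A \<union> A')"
    if B: "B \<in> sets M" "B \<subseteq> A" "B' \<in> sets M" "B' \<subseteq> A'" for B B'
  proof -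
    have "\<nu> (B \<union> B') = \<nu> B + \<nu> B'" using sigma_additive_Un[OF \<nu>, of B B'] B assms(2) by blast
    moreover have "ennreal (\<nu> (B \<union> B')) \<le> upper_sup M \<nu> (A \<union> A')"
      using B by (intro upper_sup_upper) auto
    moreover have "ennreal (\<nu> B) \<le> upper_sup M \<nu> (A \<union> A')" "ennreal (\<nu> B') \<le> upper_sup M \<nu> (A \<union> A')"
      using B by (intro upper_sup_upper; auto)+
    ultimately show ?thesis
      by (cases "0 \<le> \<nu> B"; cases "0 \<le> \<nu> B'") (auto simp: ennreal_plus ennreal_neg)
  qed
  have "upper_sup M \<nu> A + upper_sup M \<nu> A'
      = (SUP B \<in> {B \<in> sets M. B \<subseteq> A}. SUP B' \<in> {B \<in> sets M. B \<subseteq> A'}. ennreal (\<nu> B) + ennreal (\<nu> B'))"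
    unfolding upper_sup_def
    by (subst ennreal_SUP_add_left[symmetric], force,
        subst ennreal_SUP_add_right[symmetric], force, rule refl)
  also have "\<dots> \<le> upper_sup M \<nu> (A \<union> A')"
    by (intro SUP_least) (use * in auto)
  finally show ?thesis .
qed

text \<open>
  A set \<open>B\<close> inside the union is cut into the pieces \<open>B \<inter> A i\<close>, which gives one inequality; superadditivity of
  finite unions and monotonicity give the other.
\<close>

lemma upper_sup_suminf:
  fixes A :: "nat \<Rightarrow> 'a set"
  assumes \<nu>: "sigma_additive M \<nu>" and A: "range A \<subseteq> sets M" "disjoint_family A"
  shows "(\<Sum>i. upper_sup M \<nu> (A i)) = upper_sup M \<nu> (\<Union>i. A i)"
proof (rule antisym)
  have "(\<Sum>i<n. upper_sup M \<nu> (A i)) \<le> upper_sup M \<nu> (\<Union>i<n. A i)" for n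
  proof (induction n)
    case 0
    then show ?case by simp
  next
    case (Suc n)
    have disj: "(\<Union>i<n. A i) \<inter> A n = {}"
      using A(2) by (auto simp: disjoint_family_on_def) (metis IntI empty_iff less_irrefl)
    have "(\<Sum>i<Suc n. upper_sup M \<nu> (A i)) \<le> upper_sup M \<nu> (\<Union>i<n. A i) + upper_sup M \<nu> (A n)"
      using Suc by (simp add: add_right_mono)
    also have "\<dots> \<le> upper_sup M \<nu> ((\<Union>i<n. A i) \<union> A n)"
      using upper_sup_super[OF \<nu> disj] .
    also have "(\<Union>i<n. A i) \<union> A n = (\<Union>i<Suc n. A i)" by (auto simp: lessThan_Suc)
    finally show ?case .
  qed
  also have "upper_sup M \<nu> (\<Union>i<n. A i) \<le> upper_sup M \<nu> (\<Union>i. A i)" for n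
    by (intro upper_sup_mono) auto
  finally show "(\<Sum>i. upper_sup M \<nu> (A i)) \<le> upper_sup M \<nu> (\<Union>i. A i)"
    by (intro suminf_le_const) auto
next
  show "upper_sup M \<nu> (\<Union>i. A i) \<le> (\<Sum>i. upper_sup M \<nu> (A i))"
    unfolding upper_sup_def[of M \<nu> "\<Union>i. A i"]
  proof (intro SUP_least)
    fix B assume "B \<in> {B \<in> sets M. B \<subseteq> (\<Union>i. A i)}"
    then have B: "B \<in> sets M" "B = (\<Union>i. B \<inter> A i)" by auto
    have sums: "(\<lambda>i. \<nu> (B \<inter> A i)) sums \<nu> (\<Union>i. B \<inter> A i)"
      using A B(1) by (intro sigma_additive_sums[OF \<nu>]) (auto simp: disjoint_family_on_def)
    show "ennreal (\<nu> B) \<le> (\<Sum>i. upper_sup M \<nu> (A i))"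
    proof (cases "(\<Sum>i. upper_sup M \<nu> (A i)) = top")
      case False
      have le: "ennreal (\<nu> (B \<inter> A i)) \<le> upper_sup M \<nu> (A i)" for i
        using A B by (intro upper_sup_upper) auto
      have "(\<Sum>i<n. \<nu> (B \<inter> A i)) \<le> enn2real (\<Sum>i. upper_sup M \<nu> (A i))" for n
      proof -
        have "ennreal (\<Sum>i<n. \<nu> (B \<inter> A i)) \<le> ennreal (\<Sum>i<n. max 0 (\<nu> (B \<inter> A i)))"
          by (intro ennreal_leI sum_mono) auto
        also have "\<dots> = (\<Sum>i<n. ennreal (max 0 (\<nu> (B \<inter> A i))))"
          by (intro sum_ennreal[symmetric]) auto
        also have "\<dots> = (\<Sum>i<n. ennreal (\<nu> (B \<inter> A i)))"
          by (intro sum.cong) (auto simp: max_def ennreal_neg)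
        also have "\<dots> \<le> (\<Sum>i<n. upper_sup M \<nu> (A i))" by (intro sum_mono le)
        also have "\<dots> \<le> (\<Sum>i. upper_sup M \<nu> (A i))" by (intro sum_le_suminf) auto
        finally show ?thesis
          using False by (metis ennreal_enn2real_if ennreal_le_iff2 enn2real_nonneg order_trans)
      qed
      then have "\<nu> B \<le> enn2real (\<Sum>i. upper_sup M \<nu> (A i))"
        using sums B(2) by (metis LIMSEQ_le_const2 sums_def)
      then show ?thesis
        using False by (metis ennreal_enn2real_if ennreal_leI)
    qed simp
  qed
qed

lemma sets_upper_variation [simp, measurable_cong]: "sets (upper_variation M \<nu>) = sets M"
  by (simp add: upper_variation_def sets.space_closed sets.sigma_sets_eq)

lemma space_upper_variation [simp]: "space (upper_variation M \<nu>) = space M"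
  by (simp add: upper_variation_def space_measure_of_conv)

lemma emeasure_upper_variation:
  assumes \<nu>: "sigma_additive M \<nu>" and "A \<in> sets M"
  shows "emeasure (upper_variation M \<nu>) A = upper_sup M \<nu> A"
proof (rule emeasure_measure_of)
  show "upper_variation M \<nu> = measure_of (space M) (sets M) (upper_sup M \<nu>)"
    by (simp add: upper_variation_def upper_sup_def[abs_def])
  show "sets M \<subseteq> Pow (space M)" by (rule sets.space_closed)
  show "A \<in> sets (upper_variation M \<nu>)" using assms by simp
  show "positive (sets (upper_variation M \<nu>)) (upper_sup M \<nu>)"
    by (simp add: positive_def upper_sup_empty[OF \<nu>])
  show "countably_additive (sets (upper_variation M \<nu>)) (upper_sup M \<nu>)"
    by (intro countably_additiveI upper_sup_suminf[OF \<nu>]) simp_all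
qed

text \<open>
  If the supremum over subsets of \<open>E\<close> is infinite, then \<open>E\<close> splits into two parts that both have mass at least
  \<open>1\<close> in absolute value, and the supremum is infinite for one of them. Repeating this with that part produces
  disjoint sets whose masses are not summable, contrary to \<open>\<sigma>\<close>-additivity.
\<close>

lemma upper_sup_finite:
  assumes \<nu>: "sigma_additive M \<nu>" shows "upper_sup M \<nu> (space M) < \<infinity>"
proof (rule ccontr)
  assume "\<not> ?thesis"
  then have inf: "upper_sup M \<nu> (space M) = top" by (metis infinity_ennreal_def top.not_eq_extremum)
  define P where "P E \<longleftrightarrow> E \<in> sets M \<and> upper_sup M \<nu> E = top" for E
  have step: "\<exists>E'. P E' \<and> E' \<subseteq> E \<and> 1 \<le> \<bar>\<nu> (E - E')\<bar>" if "P E" for E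
  proof -
    have E: "E \<in> sets M" "upper_sup M \<nu> E = top" using that by (auto simp: P_def)
    \<comment> \<open>The surplus \<open>\<bar>\<nu> E\<bar>\<close> makes the complement of \<open>A\<close> in \<open>E\<close> have mass below \<open>-1\<close>.\<close>
    have "ennreal (1 + \<bar>\<nu> E\<bar>) < upper_sup M \<nu> E"
      unfolding E(2) by (rule ennreal_less_top)
    then obtain A where A: "A \<in> sets M" "A \<subseteq> E" "ennreal (1 + \<bar>\<nu> E\<bar>) < ennreal (\<nu> A)"
      unfolding upper_sup_def less_SUP_iff by blast
    from A(3) have A3: "1 + \<bar>\<nu> E\<bar> < \<nu> A" by (subst (asm) ennreal_less_iff) auto
    have "\<nu> (E - A) = \<nu> E - \<nu> A" using sigma_additive_Diff[OF \<nu> E(1) A(1,2)] .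
    then have big: "1 \<le> \<bar>\<nu> (E - A)\<bar>" "1 \<le> \<bar>\<nu> A\<bar>" using A3 by auto
    have "upper_sup M \<nu> A + upper_sup M \<nu> (E - A) = upper_sup M \<nu> E"
    proof -
      have "disjoint_family (binaryset A (E - A))" "range (binaryset A (E - A)) \<subseteq> sets M"
        using A E by (auto simp: disjoint_family_on_def binaryset_def)
      from upper_sup_suminf[OF \<nu> this(2,1)] show ?thesis
        using A(2) by (simp add: suminf_binaryset_eq[of "upper_sup M \<nu>", OF upper_sup_empty[OF \<nu>]] UN_binaryset_eq Un_absorb1)
    qed
    then have "upper_sup M \<nu> A = top \<or> upper_sup M \<nu> (E - A) = top"
      using E(2) by (simp add: ennreal_add_eq_top)
    moreover have "E - (E - A) = A" using A(2) by blast
    ultimately show ?thesis using A E big unfolding P_def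
      by (metis Diff_subset sets.Diff)
  qed
  obtain E where E: "\<And>n. P (E n)" "\<And>n. E (Suc n) \<subseteq> E n \<and> 1 \<le> \<bar>\<nu> (E n - E (Suc n))\<bar>"
    using dependent_nat_choice[of "\<lambda>n E. P E" "\<lambda>n E E'. E' \<subseteq> E \<and> 1 \<le> \<bar>\<nu> (E - E')\<bar>"] step inf
    unfolding P_def by (metis sets.top)
  have dec: "E m \<subseteq> E n" if "n \<le> m" for n m
    using that by (rule lift_Suc_antimono_le[rotated]) (use E(2) in auto)
  have "(E m - E (Suc m)) \<inter> (E n - E (Suc n)) = {}" if "m < n" for m n
    using dec[of "Suc m" n] that by auto
  then have "disjoint_family (\<lambda>n. E n - E (Suc n))"
    unfolding disjoint_family_on_def by (metis Int_commute nat_neq_iff)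
  moreover have "range (\<lambda>n. E n - E (Suc n)) \<subseteq> sets M" using E(1) by (auto simp: P_def)
  ultimately have "summable (\<lambda>n. \<nu> (E n - E (Suc n)))"
    using sigma_additive_sums[OF \<nu>] by (blast intro: sums_summable)
  then have "(\<lambda>n. \<nu> (E n - E (Suc n))) \<longlonglongrightarrow> 0" by (rule summable_LIMSEQ_zero)
  then have "(\<lambda>n. \<bar>\<nu> (E n - E (Suc n))\<bar>) \<longlonglongrightarrow> 0" by (rule tendsto_rabs_zero)
  then have "1 \<le> (0::real)" by (rule LIMSEQ_le_const) (use E(2) in auto)
  then show False by simp
qed

lemma finite_measure_upper_variation:
  assumes "sigma_additive M \<nu>" shows "finite_measure (upper_variation M \<nu>)"
  by (intro finite_measureI) (use upper_sup_finite[OF assms] in \<open>simp add: emeasure_upper_variation[OF assms]\<close>)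

text \<open>
  Since \<open>- \<nu> B = \<nu> (A - B) - \<nu> A\<close>, the supremum of \<open>- \<nu>\<close> over subsets of \<open>A\<close> is the supremum of \<open>\<nu>\<close>
  over subsets of \<open>A\<close> minus \<open>\<nu> A\<close>. One inequality suffices, since exchanging \<open>\<nu>\<close> and \<open>- \<nu>\<close> gives the other.
\<close>

lemma Jordan_decomposition:
  assumes \<nu>: "sigma_additive M \<nu>" and A: "A \<in> sets M"
  shows "\<nu> A = measure (upper_variation M \<nu>) A - measure (upper_variation M (\<lambda>A. - \<nu> A)) A"
proof -
  interpret p: finite_measure "upper_variation M \<nu>"
    using finite_measure_upper_variation[OF \<nu>] .
  interpret n: finite_measure "upper_variation M (\<lambda>A. - \<nu> A)"
    using finite_measure_upper_variation[OF sigma_additive_uminus[OF \<nu>]] .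
  have key: "\<nu> A \<le> measure (upper_variation M \<nu>) A - measure (upper_variation M (\<lambda>A. - \<nu> A)) A"
    if \<nu>: "sigma_additive M \<nu>" for \<nu>
  proof -
    interpret p: finite_measure "upper_variation M \<nu>"
      using finite_measure_upper_variation[OF \<nu>] .
    have up: "\<nu> B \<le> measure (upper_variation M \<nu>) A" if "B \<in> sets M" "B \<subseteq> A" for B
    proof -
      have "ennreal (\<nu> B) \<le> ennreal (measure (upper_variation M \<nu>) A)"
        using upper_sup_upper[OF that, of \<nu>] emeasure_upper_variation[OF \<nu> A]
        by (simp add: p.emeasure_eq_measure)
      then show ?thesis by (cases "0 \<le> \<nu> B") (auto simp: ennreal_le_iff intro: order_trans[of _ 0])
    qed
    have "upper_sup M (\<lambda>A. - \<nu> A) A \<le> ennreal (measure (upper_variation M \<nu>) A - \<nu> A)"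
      unfolding upper_sup_def
    proof (intro SUP_least ennreal_leI)
      fix B assume "B \<in> {B \<in> sets M. B \<subseteq> A}"
      then have B: "B \<in> sets M" "B \<subseteq> A" by auto
      show "- \<nu> B \<le> measure (upper_variation M \<nu>) A - \<nu> A"
        using up[of "A - B"] sigma_additive_Diff[OF \<nu> A B] A B by auto
    qed
    moreover have "upper_sup M (\<lambda>A. - \<nu> A) A = ennreal (measure (upper_variation M (\<lambda>A. - \<nu> A)) A)"
      using emeasure_upper_variation[OF sigma_additive_uminus[OF \<nu>] A]
        finite_measure.emeasure_eq_measure[OF finite_measure_upper_variation[OF sigma_additive_uminus[OF \<nu>]]]
      by simp
    ultimately show ?thesis using up[of A] A by (simp add: ennreal_le_iff)
  qed
  from key[OF \<nu>] key[OF sigma_additive_uminus[OF \<nu>]] show ?thesis by simp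
qed

definition total_variation :: "'a measure \<Rightarrow> ('a set \<Rightarrow> real) \<Rightarrow> 'a set \<Rightarrow> real" where
  "total_variation M \<nu> A = measure (upper_variation M \<nu>) A + measure (upper_variation M (\<lambda>A. - \<nu> A)) A"

lemma total_variation_nonneg: "0 \<le> total_variation M \<nu> A"
  by (simp add: total_variation_def)

lemma total_variation_Un:
  assumes "sigma_additive M \<nu>" "A \<in> sets M" "B \<in> sets M" "A \<inter> B = {}"
  shows "total_variation M \<nu> (A \<union> B) = total_variation M \<nu> A + total_variation M \<nu> B"
  using assms finite_measure_upper_variation[OF assms(1)]
    finite_measure_upper_variation[OF sigma_additive_uminus[OF assms(1)]]
  unfolding total_variation_def by (simp add: finite_measure.finite_measure_Union)

lemma total_variation_mono:
  assumes "sigma_additive M \<nu>" "A \<in> sets M" "B \<in> sets M" "A \<subseteq> B"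
  shows "total_variation M \<nu> A \<le> total_variation M \<nu> B"
  using assms finite_measure_upper_variation[OF assms(1)]
    finite_measure_upper_variation[OF sigma_additive_uminus[OF assms(1)]]
  unfolding total_variation_def by (intro add_mono finite_measure.finite_measure_mono) auto

lemma abs_le_total_variation:
  assumes "sigma_additive M \<nu>" "A \<in> sets M"
  shows "\<bar>\<nu> A\<bar> \<le> total_variation M \<nu> A"
  unfolding Jordan_decomposition[OF assms] total_variation_def by (simp add: abs_le_iff)

lemma abs_diff_le_total_variation:
  assumes "sigma_additive M \<nu>" "A \<in> sets M" "B \<in> sets M"
  shows "\<bar>\<nu> A - \<nu> B\<bar> \<le> total_variation M \<nu> (A - B) + total_variation M \<nu> (B - A)"
proof -
  have "\<nu> A = \<nu> (A \<inter> B) + \<nu> (A - B)"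
    using sigma_additive_Un[OF assms(1), of "A \<inter> B" "A - B"] assms(2,3)
    by (simp add: Int_Diff_Un Int_Diff_disjoint sets.Int sets.Diff)
  moreover have "\<nu> B = \<nu> (B \<inter> A) + \<nu> (B - A)"
    using sigma_additive_Un[OF assms(1), of "B \<inter> A" "B - A"] assms(2,3)
    by (simp add: Int_Diff_Un Int_Diff_disjoint sets.Int sets.Diff)
  moreover have "\<bar>\<nu> (A - B)\<bar> \<le> total_variation M \<nu> (A - B)" "\<bar>\<nu> (B - A)\<bar> \<le> total_variation M \<nu> (B - A)"
    using assms by (auto intro!: abs_le_total_variation)
  ultimately show ?thesis by (simp add: Int_commute)
qed

section \<open>The circle and its arcs\<close>

lemma circle_param_in [simp]: "circle_param t \<in> unit_circle"
  by (simp add: circle_param_def unit_circle_def norm_Pair)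

lemma circle_param_surj_Ico:
  assumes "x \<in> unit_circle" obtains t where "a \<le> t" "t < a + 2 * pi" "x = circle_param t"
proof -
  obtain u v where x: "x = (u, v)" by (cases x)
  then have "u\<^sup>2 + v\<^sup>2 = 1" using assms by (simp add: unit_circle_def norm_Pair)
  then obtain s where s: "u = cos s" "v = sin s" using sincos_total_2pi by metis
  define t where "t = s - 2 * pi * of_int \<lfloor>(s - a) / (2 * pi)\<rfloor>"
  have "of_int \<lfloor>(s - a) / (2 * pi)\<rfloor> \<le> (s - a) / (2 * pi)"
    "(s - a) / (2 * pi) < of_int \<lfloor>(s - a) / (2 * pi)\<rfloor> + 1" by linarith+
  then have "of_int \<lfloor>(s - a) / (2 * pi)\<rfloor> * (2 * pi) \<le> s - a"
    "s - a < (of_int \<lfloor>(s - a) / (2 * pi)\<rfloor> + 1) * (2 * pi)"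
    by (simp_all only: pos_le_divide_eq pos_divide_less_eq zero_less_mult_iff pi_gt_zero zero_less_numeral simp_thms)
  then have "a \<le> t" "t < a + 2 * pi" by (auto simp: t_def algebra_simps)
  moreover have "x = circle_param t"
    using s x by (auto simp: circle_param_def t_def sin_diff cos_diff)
  ultimately show thesis using that by blast
qed

lemma circle_param_eq_iff:
  "circle_param s = circle_param t \<longleftrightarrow> (\<exists>n::int. s = t + 2 * pi * of_int n)"
  unfolding circle_param_def using sin_cos_eq_iff[of s t] by (auto simp: mult_ac)

lemma circle_param_periodic [simp]: "circle_param (t + 2 * pi) = circle_param t"
  by (simp add: circle_param_def)

lemma circle_param_add_pi [simp]: "circle_param (t + pi) = - circle_param t"
  by (simp add: circle_param_def)

lemma inj_on_circle_param: "inj_on circle_param {a..<a + 2 * pi}"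
proof (rule inj_onI)
  fix s t assume st: "s \<in> {a..<a + 2 * pi}" "t \<in> {a..<a + 2 * pi}" "circle_param s = circle_param t"
  then obtain n :: int where n: "s = t + 2 * pi * of_int n" by (auto simp: circle_param_eq_iff)
  then have "\<bar>2 * pi * of_int n\<bar> < 2 * pi" using st by auto
  then have "\<bar>real_of_int n\<bar> < 1" by (simp add: abs_mult)
  then have "n = 0" by linarith
  then show "s = t" using n by simp
qed

lemma circle_param_eqD:
  "\<lbrakk>circle_param s = circle_param t; \<bar>s - t\<bar> < 2 * pi\<rbrakk> \<Longrightarrow> s = t"
  by (rule inj_onD[OF inj_on_circle_param[of "min s t"]]) auto

lemma continuous_on_circle_param: "continuous_on A circle_param"
  unfolding circle_param_def by (intro continuous_intros)

lemma circle_shift_param: "circle_shift (circle_param a) t = circle_param (a + t)"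
proof -
  have "circle_param (SOME b. circle_param b = circle_param a) = circle_param a"
    by (rule someI[of _ a]) simp
  then obtain n :: int where "(SOME b. circle_param b = circle_param a) = a + 2 * pi * of_int n"
    by (auto simp: circle_param_eq_iff)
  then show ?thesis
    unfolding circle_shift_def circle_param_eq_iff by (auto intro!: exI[of _ n])
qed

lemma uminus_unit_circle: "x \<in> unit_circle \<Longrightarrow> - x \<in> unit_circle"
  by (simp add: unit_circle_def)

lemma circle_dist_param: "circle_dist (circle_param s) (circle_param t) = arccos (cos (s - t))"
  by (simp add: circle_dist_def circle_param_def cos_diff)

lemma arccos_cos_le_abs: "arccos (cos x) \<le> \<bar>x\<bar>"
proof (cases "\<bar>x\<bar> \<le> pi")
  case True
  then show ?thesis using arccos_cos[of "\<bar>x\<bar>"] by (simp add: cos_abs_real)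
next
  case False
  then show ?thesis using arccos_ubound[of "cos x"] by auto
qed

lemma arccos_cos_abs: "\<bar>x\<bar> \<le> pi \<Longrightarrow> arccos (cos x) = \<bar>x\<bar>"
  using arccos_cos[of "\<bar>x\<bar>"] by (simp add: cos_abs_real)

text \<open>
  \<open>arccos (cos x)\<close> is the distance from \<open>x\<close> to the nearest multiple of \<open>2 * pi\<close>.
\<close>

lemma arccos_cos_Lipschitz: "\<bar>arccos (cos x) - arccos (cos y)\<bar> \<le> \<bar>x - y\<bar>"
proof -
  have *: "arccos (cos y) \<le> arccos (cos x) + \<bar>x - y\<bar>" for x y :: real
  proof -
    obtain t where t: "- pi \<le> t" "t < - pi + 2 * pi" "circle_param x = circle_param t"
      using circle_param_surj_Ico[OF circle_param_in] by blast
    then obtain n :: int where n: "x = t + 2 * pi * of_int n" by (auto simp: circle_param_eq_iff)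
    have "cos y = cos (y - 2 * pi * of_int n)" by (simp add: cos_diff)
    then have "arccos (cos y) \<le> \<bar>y - 2 * pi * of_int n\<bar>" by (metis arccos_cos_le_abs)
    also have "\<dots> \<le> \<bar>t\<bar> + \<bar>x - y\<bar>" using n by auto
    also have "\<bar>t\<bar> = arccos (cos x)" using t arccos_cos_abs[of t] by (auto simp: circle_param_def)
    finally show ?thesis .
  qed
  from *[of x y] *[of y x] show ?thesis by auto
qed

lemma circle_dist_param_le: "circle_dist (circle_param s) (circle_param t) \<le> \<bar>s - t\<bar>"
  by (simp add: circle_dist_param arccos_cos_le_abs)

lemma circle_dist_param_eq:
  "\<bar>s - t\<bar> \<le> pi \<Longrightarrow> circle_dist (circle_param s) (circle_param t) = \<bar>s - t\<bar>"
  by (simp add: circle_dist_param arccos_cos_abs)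

lemma circle_dist_Lipschitz:
  assumes "y \<in> unit_circle"
  shows "\<bar>circle_dist (circle_param s) y - circle_dist (circle_param t) y\<bar> \<le> \<bar>s - t\<bar>"
proof -
  obtain b where "y = circle_param b" using circle_param_surj_Ico[OF assms] by blast
  then show ?thesis using arccos_cos_Lipschitz[of "s - b" "t - b"] by (simp add: circle_dist_param)
qed

lemma circle_dist_inner:
  assumes "x \<in> unit_circle" "y \<in> unit_circle" shows "\<bar>x \<bullet> y\<bar> \<le> 1"
  using Cauchy_Schwarz_ineq2[of x y] assms by (simp add: unit_circle_def)

lemma circle_dist_bounds:
  assumes "x \<in> unit_circle" "y \<in> unit_circle"
  shows "0 \<le> circle_dist x y" "circle_dist x y \<le> pi"
  using circle_dist_inner[OF assms] by (auto simp: circle_dist_def abs_le_iff intro!: arccos_lbound arccos_ubound)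

lemma circle_dist_uminus:
  assumes "x \<in> unit_circle" "y \<in> unit_circle"
  shows "circle_dist (- x) y = pi - circle_dist x y"
  using circle_dist_inner[OF assms] by (simp add: circle_dist_def arccos_minus abs_le_iff)

lemma circle_dist_uminus_uminus: "circle_dist (- x) (- y) = circle_dist x y"
  by (simp add: circle_dist_def)

lemma circle_dist_attained:
  assumes "x \<in> unit_circle" "y \<in> unit_circle"
  obtains s t where "x = circle_param s" "y = circle_param t" "\<bar>s - t\<bar> = circle_dist x y"
proof -
  obtain s where s: "x = circle_param s" using circle_param_surj_Ico[OF assms(1)] by blast
  obtain t where t: "s - pi \<le> t" "t < s - pi + 2 * pi" "y = circle_param t"
    using circle_param_surj_Ico[OF assms(2)] by blast
  then show thesis using that[OF s t(3)] circle_dist_param_eq[of s t] s by auto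
qed

lemma space_circle_borel [simp]: "space circle_borel = unit_circle"
  by (simp add: circle_borel_def space_restrict_space)

lemma closed_unit_circle: "closed unit_circle"
  by (simp add: unit_circle_def)

lemma sets_circle_borel_iff: "A \<in> sets circle_borel \<longleftrightarrow> A \<in> sets borel \<and> A \<subseteq> unit_circle"
  unfolding circle_borel_def
  by (subst sets_restrict_space_iff) (auto simp: closed_unit_circle borel_closed)

lemma unit_circle_sets [simp]: "unit_circle \<in> sets circle_borel"
  using sets.top[of circle_borel] by simp

lemma measurable_circle_param: "circle_param \<in> measurable borel circle_borel"
  unfolding circle_borel_def
  by (intro measurable_restrict_space2 borel_measurable_continuous_onI continuous_on_circle_param) simp

lemma measurable_uminus_circle: "uminus \<in> measurable circle_borel circle_borel"
  unfolding circle_borel_def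
  by (intro measurable_restrict_space3) (auto simp: uminus_unit_circle)

lemma measurable_circle_dist:
  assumes "x \<in> unit_circle" shows "circle_dist x \<in> borel_measurable circle_borel"
  unfolding circle_borel_def circle_dist_def
  using circle_dist_inner[OF assms]
  by (intro borel_measurable_continuous_on_restrict continuous_intros) (auto simp: abs_le_iff)

lemma uminus_vimage_unit_circle: "uminus -` A \<inter> unit_circle = uminus ` A" if "A \<subseteq> unit_circle"
  for A :: "(real \<times> real) set"
proof (intro equalityI subsetI)
  fix x assume "x \<in> uminus -` A \<inter> unit_circle"
  then have "- x \<in> A" "x = - (- x)" by auto
  then show "x \<in> uminus ` A" by (rule rev_image_eqI)
next
  fix x assume "x \<in> uminus ` A"
  then show "x \<in> uminus -` A \<inter> unit_circle" using that uminus_unit_circle by auto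
qed

lemma uminus_sets_circle: "A \<in> sets circle_borel \<Longrightarrow> uminus ` A \<in> sets circle_borel"
  using measurable_sets[OF measurable_uminus_circle, of A] sets.sets_into_space[of A circle_borel]
  by (simp add: uminus_vimage_unit_circle)

text \<open>
  Half-open arcs, so that adjacent arcs join without overlap; the closed left end matches the choice of
  left derivatives.
\<close>

definition circle_arc :: "real \<Rightarrow> real \<Rightarrow> (real \<times> real) set" where
  "circle_arc a b = circle_param ` {a..<b}"

text \<open>
  A half-open interval is a countable union of compact ones, and the image of a compact set is compact.
\<close>

lemma arc_sets [simp]: "circle_arc a b \<in> sets circle_borel"
proof -
  have "{a..<b} = (\<Union>n::nat. {a..b - inverse (Suc n)})"
  proof (intro equalityI subsetI)
    fix x assume x: "x \<in> {a..<b}"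
    then obtain n :: nat where "inverse (real (Suc n)) < b - x" using reals_Archimedean[of "b - x"] by auto
    then show "x \<in> (\<Union>n::nat. {a..b - inverse (Suc n)})" using x by (intro UN_I[of n]) auto
  next
    fix x assume "x \<in> (\<Union>n::nat. {a..b - inverse (Suc n)})"
    then obtain n :: nat where "a \<le> x" "x \<le> b - inverse (Suc n)" by auto
    moreover have "0 < inverse (real (Suc n))" by simp
    ultimately have "x < b" by linarith
    then show "x \<in> {a..<b}" using \<open>a \<le> x\<close> by simp
  qed
  then have "circle_arc a b = (\<Union>n::nat. circle_param ` {a..b - inverse (Suc n)})" unfolding circle_arc_def by (simp only: image_UN)
  moreover have "circle_param ` {a..b - inverse (Suc n)} \<in> sets borel" for n
    by (intro borel_compact compact_continuous_image continuous_on_circle_param) auto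
  ultimately show ?thesis by (auto simp: sets_circle_borel_iff simp del: of_nat_Suc)
qed

lemma arc_subset: "circle_arc a b \<subseteq> unit_circle"
  by (auto simp: circle_arc_def)

lemma arc_empty [simp]: "b \<le> a \<Longrightarrow> circle_arc a b = {}"
  by (simp add: circle_arc_def)

lemma arc_full: "circle_arc a (a + 2 * pi) = unit_circle"
  unfolding circle_arc_def by (auto elim!: circle_param_surj_Ico[of _ a])

lemma arc_Un: "\<lbrakk>a \<le> b; b \<le> c\<rbrakk> \<Longrightarrow> circle_arc a b \<union> circle_arc b c = circle_arc a c"
  unfolding circle_arc_def by (simp flip: image_Un add: ivl_disj_un)

lemma arc_disjoint: "\<lbrakk>a \<le> b; b \<le> c; c \<le> a + 2 * pi\<rbrakk> \<Longrightarrow> circle_arc a b \<inter> circle_arc b c = {}"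
  unfolding circle_arc_def by (auto dest!: circle_param_eqD)

lemma arc_uminus: "uminus ` circle_arc a b = circle_arc (a + pi) (b + pi)"
proof -
  have "{a + pi..<b + pi} = (\<lambda>t. t + pi) ` {a..<b}" by simp
  then show ?thesis unfolding circle_arc_def by (simp only: image_image circle_param_add_pi)
qed

section \<open>Hausdorff measure is arc length\<close>

lemma circle_diameter_le:
  assumes "\<And>x y. x \<in> U \<Longrightarrow> y \<in> U \<Longrightarrow> circle_dist x y \<le> d"
  shows "circle_diameter U \<le> ennreal d"
  unfolding circle_diameter_def using assms by (intro SUP_least) (auto intro!: ennreal_leI)

lemma circle_dist_le_diameter:
  "\<lbrakk>x \<in> U; y \<in> U\<rbrakk> \<Longrightarrow> ennreal (circle_dist x y) \<le> circle_diameter U"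
  unfolding circle_diameter_def by (intro SUP_upper2[of "(x, y)"]) auto

lemma circle_diameter_empty [simp]: "circle_diameter {} = 0"
  by (simp add: circle_diameter_def bot_ennreal)

lemma hausdorff1_pre_le:
  assumes "\<And>i. U i \<subseteq> unit_circle" "\<And>i. circle_diameter (U i) \<le> ennreal \<delta>" "A \<subseteq> (\<Union>i. U i)"
  shows "hausdorff1_pre \<delta> A \<le> (\<Sum>i. circle_diameter (U i))"
  unfolding hausdorff1_pre_def using assms by (intro INF_lower) auto

lemma circle_diameter_segment: "circle_diameter (circle_param ` {s..t}) \<le> ennreal (t - s)"
proof (rule circle_diameter_le)
  fix x y assume "x \<in> circle_param ` {s..t}" "y \<in> circle_param ` {s..t}"
  then obtain u v where "x = circle_param u" "y = circle_param v" "u \<in> {s..t}" "v \<in> {s..t}" by blast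
  then show "circle_dist x y \<le> t - s"
    using circle_dist_param_le[of u v] by auto
qed

lemma circle_diameter_uminus: "circle_diameter (uminus ` U) = circle_diameter U"
proof -
  have *: "circle_diameter (uminus ` U) \<le> circle_diameter U" for U
    unfolding circle_diameter_def[of "uminus ` U"]
  proof (intro SUP_least)
    fix p assume "p \<in> uminus ` U \<times> uminus ` U"
    then obtain x y where "p = (- x, - y)" "x \<in> U" "y \<in> U" by blast
    then show "(case p of (x, y) \<Rightarrow> ennreal (circle_dist x y)) \<le> circle_diameter U"
      using circle_dist_le_diameter[of x U y] by (simp only: prod.case circle_dist_uminus_uminus)
  qed
  from *[of U] *[of "uminus ` U"] show ?thesis by (simp add: image_image)
qed

lemma hausdorff1_uminus: "hausdorff1 (uminus ` A) = hausdorff1 A"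
proof -
  have *: "hausdorff1_pre \<delta> (uminus ` A) \<le> hausdorff1_pre \<delta> A" for \<delta> A
    unfolding hausdorff1_pre_def[of \<delta> A]
  proof (intro INF_greatest)
    fix U :: "nat \<Rightarrow> (real \<times> real) set"
    assume "U \<in> {U. (\<forall>i. U i \<subseteq> unit_circle \<and> circle_diameter (U i) \<le> ennreal \<delta>) \<and> A \<subseteq> (\<Union>i. U i)}"
    then have U: "U i \<subseteq> unit_circle" "circle_diameter (U i) \<le> ennreal \<delta>" "A \<subseteq> (\<Union>i. U i)" for i
      by blast+
    have "uminus ` U i \<subseteq> unit_circle" for i using U(1) uminus_unit_circle by blast
    moreover have "uminus ` A \<subseteq> (\<Union>i. uminus ` U i)" using U(3) by blast
    ultimately have "hausdorff1_pre \<delta> (uminus ` A) \<le> (\<Sum>i. circle_diameter (uminus ` U i))"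
      using U(2) by (intro hausdorff1_pre_le) (simp_all only: circle_diameter_uminus)
    then show "hausdorff1_pre \<delta> (uminus ` A) \<le> (\<Sum>i. circle_diameter (U i))"
      by (simp only: circle_diameter_uminus)
  qed
  have "hausdorff1_pre \<delta> (uminus ` A) = hausdorff1_pre \<delta> A" for \<delta>
    using *[of \<delta> A] *[of \<delta> "uminus ` A"] by (simp add: image_image)
  then show ?thesis by (simp add: hausdorff1_def)
qed

text \<open>
  Outer regularity of Lebesgue measure, in the form of a sequence of intervals. Those of a countable family of
  nonoverlapping intervals are enumerated; as the family may be finite, the sequence is filled up with the
  degenerate interval \<open>{0..0}\<close>.
\<close>

lemma lmeasurable_interval_cover:
  fixes B :: "real set"
  assumes "B \<in> lmeasurable" "B \<subseteq> {a..b}" "0 < e"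
  obtains c d :: "nat \<Rightarrow> real" where "\<And>n. c n \<le> d n" "\<And>n. d n - c n \<le> \<bar>b - a\<bar>"
    "B \<subseteq> (\<Union>n. {c n..d n})" "(\<Sum>n. ennreal (d n - c n)) \<le> ennreal (measure lebesgue B + e)"
proof -
  obtain \<D> where D: "countable \<D>"
      "\<And>K. K \<in> \<D> \<Longrightarrow> K \<subseteq> cbox a b \<and> K \<noteq> {} \<and> (\<exists>c d. K = cbox c d)"
      "pairwise (\<lambda>A B. interior A \<inter> interior B = {}) \<D>"
      "B \<subseteq> \<Union>\<D>" "\<Union>\<D> \<in> lmeasurable" "measure lebesgue (\<Union>\<D>) \<le> measure lebesgue B + e"
  proof (rule measurable_outer_intervals_bounded[OF assms(1) _ assms(3), of a b])
    show "B \<subseteq> cbox a b" using assms(2) by simp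
  qed (rule that)
  have "\<exists>c d. K = {c..d} \<and> c \<le> d \<and> d - c \<le> \<bar>b - a\<bar>" if K': "K \<in> \<D>" for K
  proof -
    obtain c d where K: "K = {c..d}" using D(2)[OF K'] by auto
    then have "c \<le> d" using D(2)[OF K'] by auto
    moreover have "a \<le> c" "d \<le> b" using D(2)[OF K'] K \<open>c \<le> d\<close> by auto
    ultimately show ?thesis using K by (intro exI[of _ c] exI[of _ d]) auto
  qed
  then obtain lo hi where lh: "\<And>K. K \<in> \<D> \<Longrightarrow> K = {lo K..hi K} \<and> lo K \<le> hi K \<and> hi K - lo K \<le> \<bar>b - a\<bar>"
    by metis
  define I where "I = to_nat_on \<D> ` \<D>"
  define c where "c n = (if n \<in> I then lo (from_nat_into \<D> n) else 0)" for n
  define d where "d n = (if n \<in> I then hi (from_nat_into \<D> n) else 0)" for n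
  have fn: "from_nat_into \<D> n \<in> \<D>" "to_nat_on \<D> (from_nat_into \<D> n) = n" if "n \<in> I" for n
    using that D(1) by (auto simp: I_def)
  have Kn: "from_nat_into \<D> n = {c n..d n}" if "n \<in> I" for n
    using lh[OF fn(1)[OF that]] that by (simp add: c_def d_def)
  show thesis
  proof
    show cd: "c n \<le> d n" "d n - c n \<le> \<bar>b - a\<bar>" for n
      using lh[OF fn(1)] by (auto simp: c_def d_def)
    show "B \<subseteq> (\<Union>n. {c n..d n})"
    proof
      fix x assume "x \<in> B"
      then obtain K where K: "K \<in> \<D>" "x \<in> K" using D(4) by auto
      then have "to_nat_on \<D> K \<in> I" "from_nat_into \<D> (to_nat_on \<D> K) = K"
        using D(1) by (auto simp: I_def)
      then show "x \<in> (\<Union>n. {c n..d n})" using Kn K(2) by (metis UN_iff UNIV_I)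
    qed
    have disj: "disjoint_family (\<lambda>n. {c n<..<d n})"
      unfolding disjoint_family_on_def
    proof (intro ballI impI)
      fix m n :: nat assume "m \<noteq> n"
      show "{c m<..<d m} \<inter> {c n<..<d n} = {}"
      proof (cases "m \<in> I \<and> n \<in> I")
        case True
        then have "from_nat_into \<D> m \<noteq> from_nat_into \<D> n" using fn(2) \<open>m \<noteq> n\<close> by metis
        then have "interior {c m..d m} \<inter> interior {c n..d n} = {}"
          using D(3) fn(1) True Kn unfolding pairwise_def by metis
        then show ?thesis by (simp add: interior_atLeastAtMost_real)
      next
        case False
        then show ?thesis by (auto simp: c_def d_def)
      qed
    qed
    have "(\<Sum>n. ennreal (d n - c n)) = (\<Sum>n. emeasure lborel {c n<..<d n})"
      using cd(1) by simp
    also have "\<dots> = emeasure lborel (\<Union>n. {c n<..<d n})"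
      using disj by (intro suminf_emeasure) auto
    also have "\<dots> = emeasure lebesgue (\<Union>n. {c n<..<d n})" by simp
    also have "\<dots> \<le> emeasure lebesgue (\<Union>\<D>)"
    proof (intro emeasure_mono)
      have "{c n<..<d n} \<subseteq> \<Union>\<D>" for n
      proof (cases "n \<in> I")
        case True
        then have "{c n<..<d n} \<subseteq> from_nat_into \<D> n" using Kn by auto
        then show ?thesis using fn(1)[OF True] by blast
      qed (simp add: c_def d_def)
      then show "(\<Union>n. {c n<..<d n}) \<subseteq> \<Union>\<D>" by blast
    qed (use D(5) in auto)
    also have "\<dots> = ennreal (measure lebesgue (\<Union>\<D>))"
      using D(5) by (simp add: emeasure_eq_measure2)
    also have "\<dots> \<le> ennreal (measure lebesgue B + e)" using D(6) by (rule ennreal_leI)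
    finally show "(\<Sum>n. ennreal (d n - c n)) \<le> ennreal (measure lebesgue B + e)" .
  qed
qed

definition angles :: "(real \<times> real) set \<Rightarrow> real set" where
  "angles A = {t \<in> {0..<2 * pi}. circle_param t \<in> A}"

lemma angles_borel: "A \<in> sets circle_borel \<Longrightarrow> angles A \<in> sets borel"
proof -
  assume "A \<in> sets circle_borel"
  then have "circle_param -` A \<inter> space borel \<in> sets borel"
    by (rule measurable_sets[OF measurable_circle_param])
  moreover have "angles A = (circle_param -` A \<inter> space borel) \<inter> {0..<2 * pi}"
    by (auto simp: angles_def)
  ultimately show ?thesis by simp
qed

text \<open>
  Each interval is cut into equally many pieces, short enough for the mesh \<open>\<delta>\<close>. This changes neither the
  union nor the total length.
\<close>

lemma hausdorff1_pre_interval_cover: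
  assumes "0 < \<delta>" and cd: "\<And>n. c n \<le> d n" "\<And>n. d n - c n \<le> L"
    and A: "A \<subseteq> circle_param ` (\<Union>n. {c n..d n})"
  shows "hausdorff1_pre \<delta> A \<le> (\<Sum>n. ennreal (d n - c n))"
proof -
  obtain N :: nat where N: "0 < N" "L / \<delta> \<le> real N"
  proof -
    obtain N :: nat where "L / \<delta> < real N" using reals_Archimedean2 by blast
    then show thesis by (intro that[of "Suc N"]) auto
  qed
  define p where "p n j = c n + real j * ((d n - c n) / N)" for n j
  define V where "V = (\<lambda>(n, j). if j < N then circle_param ` {p n j..p n (Suc j)} else {})"
  have p_Suc: "p n (Suc j) = p n j + (d n - c n) / N" for n j
    by (simp add: p_def distrib_right add_divide_distrib)
  have p_N: "p n 0 = c n" "p n N = d n" for n using N(1) by (simp_all add: p_def)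
  have piece: "circle_diameter (V (n, j)) \<le> (if j < N then ennreal ((d n - c n) / N) else 0)" for n j
    using circle_diameter_segment[of "p n j" "p n (Suc j)"] by (simp add: V_def p_Suc)
  have small: "(d n - c n) / N \<le> \<delta>" for n
  proof -
    have "L \<le> N * \<delta>" using N(2) assms(1) by (simp add: pos_divide_le_eq)
    then show ?thesis using cd(2)[of n] N(1) by (simp add: pos_divide_le_eq mult.commute)
  qed
  have "hausdorff1_pre \<delta> A \<le> (\<Sum>i. circle_diameter (V (prod_decode i)))"
  proof (intro hausdorff1_pre_le)
    fix i
    obtain n j where nj: "prod_decode i = (n, j)" by fastforce
    show "V (prod_decode i) \<subseteq> unit_circle" by (auto simp: nj V_def)
    have "circle_diameter (V (n, j)) \<le> ennreal ((d n - c n) / N)"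
      using piece[of n j] by (auto split: if_splits intro: order_trans)
    then show "circle_diameter (V (prod_decode i)) \<le> ennreal \<delta>"
      unfolding nj using ennreal_leI[OF small[of n]] by (rule order_trans)
  next
    show "A \<subseteq> (\<Union>i. V (prod_decode i))"
    proof
      fix x assume "x \<in> A"
      then have "x \<in> circle_param ` (\<Union>n. {c n..d n})" using A by blast
      then obtain n t where t: "x = circle_param t" "c n \<le> t" "t \<le> d n" by auto
      show "x \<in> (\<Union>i. V (prod_decode i))"
      proof -
        have "\<exists>j<N. p n j \<le> t \<and> t \<le> p n (Suc j)"
        proof (rule ccontr)
          assume neg: "\<not> ?thesis"
          have "p n j \<le> t" if "j \<le> N" for j
            using that
          proof (induction j)
            case 0
            then show ?case using t(2) by (simp add: p_N)
          next
            case (Suc j)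
            then show ?case using neg by (meson Suc_leD Suc_le_lessD linear)
          qed
          then have "p n (N - 1) \<le> t" by simp
          moreover have "t \<le> p n (Suc (N - 1))" using N(1) t(3) by (simp add: p_N)
          ultimately show False using neg N(1) by (meson diff_less zero_less_one)
        qed
        then obtain j where "j < N" "t \<in> {p n j..p n (Suc j)}" by auto
        then have "x \<in> V (n, j)" using t(1) by (simp add: V_def)
        then have "x \<in> V (prod_decode (prod_encode (n, j)))" by simp
        then show ?thesis by blast
      qed
    qed
  qed
  also have "\<dots> \<le> (\<Sum>i. (\<lambda>(n, j). if j < N then ennreal ((d n - c n) / N) else 0) (prod_decode i))"
    using piece by (intro suminf_le) (auto split: prod.splits)
  also have "\<dots> = (\<Sum>n. ennreal (d n - c n))"
  proof (rule suminf_ennreal_2dimen)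
    fix n
    have "(\<Sum>j. if j < N then ennreal ((d n - c n) / N) else 0) = (\<Sum>j<N. ennreal ((d n - c n) / N))"
      by (subst suminf_finite[of "{..<N}"]) auto
    also have "\<dots> = ennreal (d n - c n)"
      using N(1) cd(1)[of n] by (simp add: ennreal_of_nat_eq_real_of_nat flip: ennreal_mult)
    finally show "ennreal (d n - c n) = (\<Sum>j. case (n, j) of (n, j) \<Rightarrow> if j < N then ennreal ((d n - c n) / N) else 0)"
      by simp
  qed
  finally show ?thesis .
qed

lemma hausdorff1_le:
  assumes A: "A \<in> sets circle_borel"
  shows "hausdorff1 A \<le> emeasure lborel (angles A)"
proof -
  note B = angles_borel[OF A]
  have sub: "angles A \<subseteq> {0..2 * pi}" by (auto simp: angles_def)
  have lm: "angles A \<in> lmeasurable"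
    using B sub by (intro bounded_set_imp_lmeasurable) (auto intro: bounded_subset[OF bounded_closed_interval])
  have em: "emeasure lborel (angles A) = ennreal (measure lebesgue (angles A))"
    using B emeasure_eq_measure2[OF lm] by simp
  have Asub: "A \<subseteq> circle_param ` angles A"
  proof
    fix x assume x: "x \<in> A"
    then have "x \<in> unit_circle" using A by (auto simp: sets_circle_borel_iff)
    then obtain t where "0 \<le> t" "t < 0 + 2 * pi" "x = circle_param t" by (rule circle_param_surj_Ico)
    then show "x \<in> circle_param ` angles A" using x by (auto simp: angles_def)
  qed
  have "hausdorff1_pre \<delta> A \<le> emeasure lborel (angles A)" if "0 < \<delta>" for \<delta>
  proof (rule ennreal_le_epsilon)
    fix e :: real assume "0 < e"
    obtain c d :: "nat \<Rightarrow> real" where cd: "\<And>n. c n \<le> d n" "\<And>n. d n - c n \<le> \<bar>2 * pi - 0\<bar>"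
      "angles A \<subseteq> (\<Union>n. {c n..d n})" "(\<Sum>n. ennreal (d n - c n)) \<le> ennreal (measure lebesgue (angles A) + e)"
      by (rule lmeasurable_interval_cover[OF lm sub \<open>0 < e\<close>]) (rule that)
    have "hausdorff1_pre \<delta> A \<le> (\<Sum>n. ennreal (d n - c n))"
      by (rule hausdorff1_pre_interval_cover[OF that cd(1,2) order_trans[OF Asub image_mono[OF cd(3)]]])
    also have "\<dots> \<le> ennreal (measure lebesgue (angles A)) + ennreal e"
      using cd(4) \<open>0 < e\<close> by (simp add: ennreal_plus)
    finally show "hausdorff1_pre \<delta> A \<le> emeasure lborel (angles A) + ennreal e" by (simp add: em)
  qed
  then show ?thesis unfolding hausdorff1_def by (intro SUP_least) auto
qed

text \<open>
  A set of diameter \<open>d \<le> 1 / 2\<close> lies in an arc of length \<open>d\<close>. Its angles form a set of diameter at most \<open>d\<close>,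
  unless the arc passes through the point of angle \<open>0\<close>; in that case they lie in \<open>{0..b} \<union> {b + 2 * pi - d..2 * pi}\<close>
  for some \<open>b\<close>.
\<close>

lemma angles_cover:
  assumes U: "U \<subseteq> unit_circle" "circle_diameter U \<le> ennreal (1 / 2)"
  shows "\<exists>V\<in>sets borel. angles U \<subseteq> V \<and> emeasure lborel V \<le> circle_diameter U"
proof (cases "angles U = {}")
  case True
  then show ?thesis by (intro bexI[of _ "{}"]) auto
next
  case False
  define d where "d = enn2real (circle_diameter U)"
  have diam: "circle_diameter U = ennreal d"
    unfolding d_def by (rule ennreal_enn2real[symmetric, OF le_less_trans[OF U(2) ennreal_less_top]])
  have d: "0 \<le> d" "d \<le> 1 / 2"
    using U(2) ennreal_le_iff[of "1 / 2" d] unfolding diam by (simp_all only: d_def enn2real_nonneg)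
  have dist: "t - s \<le> d \<or> 2 * pi - d \<le> t - s" if "s \<in> angles U" "t \<in> angles U" "s \<le> t" for s t
  proof -
    have "ennreal (circle_dist (circle_param s) (circle_param t)) \<le> ennreal d"
      using circle_dist_le_diameter[of "circle_param s" U "circle_param t"] that diam by (simp add: angles_def)
    then have le: "circle_dist (circle_param s) (circle_param t) \<le> d" using d by (simp add: ennreal_le_iff)
    show ?thesis
    proof (cases "t - s \<le> pi")
      case True
      then show ?thesis using le circle_dist_param_eq[of s t] that by auto
    next
      case False
      then have "\<bar>s + 2 * pi - t\<bar> \<le> pi" using that by (auto simp: angles_def)
      then show ?thesis using le circle_dist_param_eq[of "s + 2 * pi" t] that by auto
    qed
  qed
  have dist': "\<bar>t - s\<bar> \<le> d \<or> 2 * pi - d \<le> \<bar>t - s\<bar>" if "s \<in> angles U" "t \<in> angles U" for s t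
    using dist[OF that] dist[OF that(2,1)] by linarith
  show ?thesis
  proof (cases "\<forall>s\<in>angles U. \<forall>t\<in>angles U. s \<le> t \<longrightarrow> t - s \<le> d")
    case True
    have bdd: "bdd_below (angles U)" by (auto simp: angles_def intro!: bdd_belowI[of _ 0])
    have "angles U \<subseteq> {Inf (angles U)..Inf (angles U) + d}"
    proof
      fix t assume t: "t \<in> angles U"
      have "t - d \<le> Inf (angles U)"
      proof (rule cInf_greatest[OF False])
        fix s assume "s \<in> angles U"
        then have "s \<le> t \<Longrightarrow> t - s \<le> d" using True t by blast
        then show "t - d \<le> s" using d(1) by linarith
      qed
      then show "t \<in> {Inf (angles U)..Inf (angles U) + d}"
        using cInf_lower[OF t bdd] by auto
    qed
    then show ?thesis using d(1) diam by (intro bexI[of _ "{Inf (angles U)..Inf (angles U) + d}"]) auto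
  next
    case False
    then obtain s0 t0 where st0: "s0 \<in> angles U" "t0 \<in> angles U" "s0 \<le> t0" "2 * pi - d \<le> t0 - s0"
      using dist by blast
    have rng: "0 \<le> t" "t < 2 * pi" if "t \<in> angles U" for t using that by (auto simp: angles_def)
    \<comment> \<open>Two angles differ by almost \<open>2 * pi\<close>, so all angles lie close to \<open>0\<close> or to \<open>2 * pi\<close>.\<close>
    define S where "S = {s \<in> angles U. s \<le> pi}"
    have s0: "s0 \<in> S" "s0 \<le> d" "2 * pi - d \<le> t0" using st0 rng[of s0] rng[of t0] d pi_ge_two by (auto simp: S_def)
    have far: "2 * pi - d \<le> t - s" if s: "s \<in> S" and t: "t \<in> angles U" "pi < t" for s t
    proof -
      have sU: "s \<in> angles U" "s \<le> pi" using s by (auto simp: S_def)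
      have "s \<le> 2 * d"
        using dist'[OF st0(1) sU(1)] sU(2) s0(2) rng[OF sU(1)] rng[OF st0(1)] d pi_ge_two by linarith
      moreover have "2 * pi - 2 * d \<le> t"
        using dist'[OF st0(2) t(1)] t(2) s0(3) rng[OF t(1)] rng[OF st0(2)] d pi_ge_two by linarith
      ultimately show ?thesis using dist'[OF sU(1) t(1)] d pi_ge_two by linarith
    qed
    have bdd: "bdd_above S" by (auto simp: S_def intro!: bdd_aboveI[of _ pi])
    define b where "b = Sup S"
    have S: "0 \<le> s" "s \<le> b" if "s \<in> S" for s
      using that rng cSup_upper[OF that bdd] by (auto simp: S_def b_def)
    have T: "b + 2 * pi - d \<le> t" if "t \<in> angles U" "pi < t" for t
    proof -
      have "b \<le> t - 2 * pi + d" unfolding b_def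
        using far[OF _ that] s0 by (intro cSup_least) fastforce+
      then show ?thesis by simp
    qed
    have b: "0 \<le> b" "b \<le> d"
      using S[OF s0(1)] T[OF st0(2)] rng[OF st0(2)] s0(3) d pi_ge_two by linarith+
    let ?V = "{0..b} \<union> {b + 2 * pi - d..2 * pi}"
    have "emeasure lborel ?V \<le> emeasure lborel {0..b} + emeasure lborel {b + 2 * pi - d..2 * pi}"
      by (intro emeasure_subadditive) auto
    also have "\<dots> = ennreal d" using b by (simp flip: ennreal_plus)
    finally have "emeasure lborel ?V \<le> circle_diameter U" by (simp add: diam)
    moreover have "angles U \<subseteq> ?V"
    proof
      fix t assume t: "t \<in> angles U"
      then show "t \<in> ?V" using S[of t] T[of t] rng[of t] by (cases "t \<le> pi") (auto simp: S_def)
    qed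
    ultimately show ?thesis by (intro bexI[of _ ?V]) auto
  qed
qed

lemma hausdorff1_ge:
  assumes A: "A \<in> sets circle_borel"
  shows "emeasure lborel (angles A) \<le> hausdorff1 A"
proof -
  have "emeasure lborel (angles A) \<le> hausdorff1_pre (1 / 2) A"
    unfolding hausdorff1_pre_def
  proof (intro INF_greatest)
    fix U :: "nat \<Rightarrow> (real \<times> real) set"
    assume "U \<in> {U. (\<forall>i. U i \<subseteq> unit_circle \<and> circle_diameter (U i) \<le> ennreal (1 / 2)) \<and> A \<subseteq> (\<Union>i. U i)}"
    then have U: "\<And>i. U i \<subseteq> unit_circle" "\<And>i. circle_diameter (U i) \<le> ennreal (1 / 2)" "A \<subseteq> (\<Union>i. U i)"
      by auto
    have "\<forall>i. \<exists>V. V \<in> sets borel \<and> angles (U i) \<subseteq> V \<and> emeasure lborel V \<le> circle_diameter (U i)"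
      using angles_cover[OF U(1,2)] by blast
    then obtain V where V: "\<And>i. V i \<in> sets borel" "\<And>i. angles (U i) \<subseteq> V i"
      "\<And>i. emeasure lborel (V i) \<le> circle_diameter (U i)"
      by metis
    have "angles A \<subseteq> (\<Union>i. V i)"
    proof
      fix t assume t: "t \<in> angles A"
      then obtain i where "circle_param t \<in> U i" using U(3) by (auto simp: angles_def)
      then have "t \<in> angles (U i)" using t by (simp add: angles_def)
      then show "t \<in> (\<Union>i. V i)" using V(2) by blast
    qed
    then have "emeasure lborel (angles A) \<le> emeasure lborel (\<Union>i. V i)"
      using V(1) by (intro emeasure_mono) auto
    also have "\<dots> \<le> (\<Sum>i. emeasure lborel (V i))"
      using V(1) by (intro emeasure_subadditive_countably) auto
    also have "\<dots> \<le> (\<Sum>i. circle_diameter (U i))" by (intro suminf_le V(3)) auto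
    finally show "emeasure lborel (angles A) \<le> (\<Sum>i. circle_diameter (U i))" .
  qed
  also have "\<dots> \<le> hausdorff1 A" unfolding hausdorff1_def by (intro SUP_upper) auto
  finally show ?thesis .
qed

text \<open>
  The upper bound comes from efficient covers by intervals, the lower bound from the fact that the sets of a
  cover lie in arcs as long as their diameters.
\<close>

lemma hausdorff1_eq: "A \<in> sets circle_borel \<Longrightarrow> hausdorff1 A = emeasure lborel (angles A)"
  by (intro antisym hausdorff1_le hausdorff1_ge)

lemma hausdorff1_unit_circle: "hausdorff1 unit_circle = ennreal (2 * pi)"
proof -
  have "angles unit_circle = {0..<2 * pi}" by (auto simp: angles_def)
  then show ?thesis by (simp add: hausdorff1_eq)
qed

lemma normalized_hausdorff1_eq:
  assumes "A \<in> sets circle_borel"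
  shows "normalized_hausdorff1 A = measure lborel (angles A) / (2 * pi)"
proof -
  have "emeasure lborel (angles A) \<le> emeasure lborel {0..<2 * pi}"
    by (intro emeasure_mono) (auto simp: angles_def)
  then have "emeasure lborel (angles A) \<le> ennreal (2 * pi)" by simp
  then have "emeasure lborel (angles A) \<noteq> top"
    by (intro less_imp_neq le_less_trans[OF _ ennreal_less_top])
  then have "emeasure lborel (angles A) = ennreal (measure lborel (angles A))"
    by (rule emeasure_eq_ennreal_measure)
  then show ?thesis
    unfolding normalized_hausdorff1_def hausdorff1_unit_circle hausdorff1_eq[OF assms]
    by (simp add: divide_ennreal)
qed

lemma normalized_hausdorff1_unit_circle: "normalized_hausdorff1 unit_circle = 1"
  unfolding normalized_hausdorff1_def hausdorff1_unit_circle by (simp add: divide_ennreal)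

lemma normalized_hausdorff1_uminus: "normalized_hausdorff1 (uminus ` A) = normalized_hausdorff1 A"
  by (simp add: normalized_hausdorff1_def hausdorff1_uminus)

lemma sigma_additive_normalized_hausdorff1: "sigma_additive circle_borel normalized_hausdorff1"
proof -
  let ?N = "restrict_space lborel {0..<2 * pi}"
  have "finite_measure ?N"
    by (intro finite_measureI) (simp add: emeasure_restrict_space space_restrict_space)
  moreover have "circle_param \<in> measurable ?N circle_borel"
    using measurable_circle_param by (intro measurable_restrict_space1) simp
  ultimately have sa: "sigma_additive circle_borel (\<lambda>A. measure ?N (circle_param -` A \<inter> space ?N))"
    by (rule sigma_additive_measure_vimage)
  have "normalized_hausdorff1 A = (1 / (2 * pi)) * measure ?N (circle_param -` A \<inter> space ?N)"
    if "A \<in> sets circle_borel" for A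
  proof -
    have "circle_param -` A \<inter> space ?N = angles A" by (auto simp: angles_def space_restrict_space)
    moreover have "measure ?N (angles A) = measure lborel (angles A)"
      by (intro measure_restrict_space) (auto simp: angles_def)
    ultimately show ?thesis using normalized_hausdorff1_eq[OF that] by simp
  qed
  with sigma_additive_cmult[OF sa] show ?thesis by (rule sigma_additive_cong)
qed

section \<open>Potentials of signed measures\<close>

text \<open>
  Statements about potentials are shown for finite measures and then transferred to signed measures through
  the Jordan decomposition.
\<close>

locale finite_circle_measure = finite_measure N for N :: "(real \<times> real) measure" +
  assumes sets_N [measurable_cong]: "sets N = sets circle_borel"
begin

lemma space_N: "space N = unit_circle"
  using sets_eq_imp_space_eq[OF sets_N] by simp

lemma arc_sets_N [simp]: "circle_arc a b \<in> sets N"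
  by (simp add: sets_N)

lemma measurable_circle_dist_N: "x \<in> unit_circle \<Longrightarrow> circle_dist x \<in> borel_measurable N"
  using measurable_circle_dist[of x] measurable_cong_sets[OF sets_N refl] by blast

lemma integrable_circle_dist: "x \<in> unit_circle \<Longrightarrow> integrable N (circle_dist x)"
  using circle_dist_bounds[of x]
  by (intro integrable_const_bound[of _ pi] measurable_circle_dist_N AE_I2) (auto simp: space_N)

lemma integral_circle_dist_uminus:
  assumes "x \<in> unit_circle"
  shows "(LINT y|N. circle_dist (- x) y) = pi * measure N unit_circle - (LINT y|N. circle_dist x y)"
proof -
  have "(LINT y|N. circle_dist (- x) y) = (LINT y|N. pi - circle_dist x y)"
    using assms by (intro Bochner_Integration.integral_cong) (auto simp: space_N circle_dist_uminus)
  also have "\<dots> = pi * measure N unit_circle - (LINT y|N. circle_dist x y)"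
    using integrable_circle_dist[OF assms] by (simp add: space_N)
  finally show ?thesis .
qed

lemma integral_circle_dist_Lipschitz:
  "\<bar>(LINT y|N. circle_dist (circle_param s) y) - (LINT y|N. circle_dist (circle_param t) y)\<bar>
    \<le> measure N unit_circle * \<bar>s - t\<bar>"
proof -
  let ?g = "\<lambda>y. circle_dist (circle_param s) y - circle_dist (circle_param t) y"
  have int: "integrable N ?g"
    by (intro Bochner_Integration.integrable_diff integrable_circle_dist) auto
  have "(LINT y|N. circle_dist (circle_param s) y) - (LINT y|N. circle_dist (circle_param t) y) = (LINT y|N. ?g y)"
    by (intro Bochner_Integration.integral_diff[symmetric] integrable_circle_dist) auto
  also have "\<bar>\<dots>\<bar> \<le> (LINT y|N. \<bar>?g y\<bar>)" by (rule integral_abs_bound)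
  also have "\<dots> \<le> (LINT y|N. \<bar>s - t\<bar>)"
    using int circle_dist_Lipschitz
    by (intro integral_mono integrable_abs) (auto simp: space_N)
  also have "\<dots> = measure N unit_circle * \<bar>s - t\<bar>" by (simp add: space_N)
  finally show ?thesis .
qed

text \<open>
  The difference quotients of the distance are bounded by \<open>1\<close>, and at each point they are eventually constant:
  \<open>1\<close> on the half circle before \<open>a\<close>, whose first point \<open>a - pi\<close> also comes closer when \<open>a\<close> decreases, and
  \<open>- 1\<close> on the half circle after \<open>a\<close>, including \<open>a\<close> itself. Dominated convergence applies.
\<close>

lemma integral_circle_dist_left_derivative:
  "((\<lambda>t. ((LINT y|N. circle_dist (circle_param (a + t)) y) - (LINT y|N. circle_dist (circle_param a) y)) / t)
     \<longlongrightarrow> measure N (circle_arc (a - pi) a) - measure N (circle_arc a (a + pi))) (at_left 0)"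
  unfolding tendsto_at_iff_sequentially comp_def
proof (intro allI impI)
  fix X :: "nat \<Rightarrow> real"
  assume X: "\<forall>i. X i \<in> {..<0} - {0}" and lim: "X \<longlonglongrightarrow> 0"
  have neg: "X i < 0" for i using X by auto
  define g where "g t y = (circle_dist (circle_param (a + t)) y - circle_dist (circle_param a) y) / t" for t y
  define h :: "real \<times> real \<Rightarrow> real"
    where "h y = indicator (circle_arc (a - pi) a) y - indicator (circle_arc a (a + pi)) y" for y
  have g_int: "integrable N (g t)" for t
    unfolding g_def by (intro integrable_divide Bochner_Integration.integrable_diff integrable_circle_dist) auto
  have ptw: "(\<lambda>i. g (X i) y) \<longlonglongrightarrow> h y" if "y \<in> unit_circle" for y
  proof -
    obtain b where b: "a - pi \<le> b" "b < a - pi + 2 * pi" "y = circle_param b"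
      using circle_param_surj_Ico[OF \<open>y \<in> unit_circle\<close>] by blast
    have disj: "circle_arc (a - pi) a \<inter> circle_arc a (a + pi) = {}" by (intro arc_disjoint) auto
    show ?thesis
    proof (cases "b < a")
      case True
      then have "y \<in> circle_arc (a - pi) a" using b by (auto simp: circle_arc_def)
      then have h: "h y = 1" using disj by (auto simp: h_def indicator_def)
      have "eventually (\<lambda>i. b - a < X i) sequentially"
        using order_tendstoD(1)[OF lim, of "b - a"] True by simp
      then have "eventually (\<lambda>i. g (X i) y = h y) sequentially"
      proof eventually_elim
        fix i assume "b - a < X i"
        then have "circle_dist (circle_param (a + X i)) y = a + X i - b"
          "circle_dist (circle_param a) y = a - b"
          using b True neg[of i] by (auto simp: circle_dist_param_eq)
        then show "g (X i) y = h y" using neg[of i] by (simp add: g_def h)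
      qed
      then show ?thesis by (rule tendsto_eventually)
    next
      case False
      then have "y \<in> circle_arc a (a + pi)" using b by (auto simp: circle_arc_def)
      then have h: "h y = - 1" using disj by (auto simp: h_def indicator_def)
      have "eventually (\<lambda>i. b - a - pi < X i) sequentially"
        using order_tendstoD(1)[OF lim, of "b - a - pi"] b by simp
      then have "eventually (\<lambda>i. g (X i) y = h y) sequentially"
      proof eventually_elim
        fix i assume "b - a - pi < X i"
        then have "circle_dist (circle_param (a + X i)) y = b - a - X i"
          "circle_dist (circle_param a) y = b - a"
          using b False neg[of i] by (auto simp: circle_dist_param_eq)
        then show "g (X i) y = h y" using neg[of i] by (simp add: g_def h)
      qed
      then show ?thesis by (rule tendsto_eventually)
    qed
  qed
  have "(\<lambda>i. LINT y|N. g (X i) y) \<longlonglongrightarrow> (LINT y|N. h y)"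
  proof (rule integral_dominated_convergence[where w = "\<lambda>_. 1"])
    show "h \<in> borel_measurable N" unfolding h_def
      by (intro borel_measurable_diff borel_measurable_indicator arc_sets_N)
    show "g (X i) \<in> borel_measurable N" for i using g_int by (rule borel_measurable_integrable)
    show "AE y in N. (\<lambda>i. g (X i) y) \<longlonglongrightarrow> h y" using ptw by (intro AE_I2) (simp add: space_N)
    show "AE y in N. norm (g (X i) y) \<le> 1" for i
    proof (intro AE_I2)
      fix y assume "y \<in> space N"
      then show "norm (g (X i) y) \<le> 1"
        using circle_dist_Lipschitz[of y "a + X i" a] neg[of i] by (simp add: g_def space_N divide_simps)
    qed
  qed simp
  moreover have "(LINT y|N. h y) = measure N (circle_arc (a - pi) a) - measure N (circle_arc a (a + pi))"
    unfolding h_def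
    by (subst Bochner_Integration.integral_diff) (auto simp: less_top[symmetric])
  moreover have "(LINT y|N. g t y)
      = ((LINT y|N. circle_dist (circle_param (a + t)) y) - (LINT y|N. circle_dist (circle_param a) y)) / t" for t
    unfolding g_def
    by (simp add: Bochner_Integration.integral_diff integrable_circle_dist)
  ultimately show "(\<lambda>i. ((LINT y|N. circle_dist (circle_param (a + X i)) y)
      - (LINT y|N. circle_dist (circle_param a) y)) / X i)
      \<longlonglongrightarrow> measure N (circle_arc (a - pi) a) - measure N (circle_arc a (a + pi))"
    by simp
qed

end

lemma finite_circle_measure_upper_variation:
  "sigma_additive circle_borel \<kappa> \<Longrightarrow> finite_circle_measure (upper_variation circle_borel \<kappa>)"
  by (simp add: finite_circle_measure_def finite_circle_measure_axioms_def finite_measure_upper_variation)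

definition potential :: "((real \<times> real) set \<Rightarrow> real) \<Rightarrow> real \<times> real \<Rightarrow> real" where
  "potential \<kappa> x = signed_integral circle_borel \<kappa> (circle_dist x)"

lemma half_circles:
  "circle_arc (a - pi) a \<union> circle_arc a (a + pi) = unit_circle"
  "circle_arc (a - pi) a \<inter> circle_arc a (a + pi) = {}"
proof -
  have "a - pi + 2 * pi = a + pi" by simp
  then show "circle_arc (a - pi) a \<union> circle_arc a (a + pi) = unit_circle"
    using arc_Un[of "a - pi" a "a + pi"] arc_full[of "a - pi"] by (simp only:) auto
  show "circle_arc (a - pi) a \<inter> circle_arc a (a + pi) = {}"
    by (rule arc_disjoint) auto
qed

context
  fixes \<kappa> :: "(real \<times> real) set \<Rightarrow> real"
  assumes \<kappa>: "sigma_additive circle_borel \<kappa>"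
begin

interpretation pos: finite_circle_measure "upper_variation circle_borel \<kappa>"
  using finite_circle_measure_upper_variation[OF \<kappa>] .

interpretation neg: finite_circle_measure "upper_variation circle_borel (\<lambda>A. - \<kappa> A)"
  using finite_circle_measure_upper_variation[OF sigma_additive_uminus[OF \<kappa>]] .

lemma potential_uminus:
  assumes "x \<in> unit_circle"
  shows "potential \<kappa> x + potential \<kappa> (- x) = pi * \<kappa> unit_circle"
proof -
  have "\<kappa> unit_circle = measure (upper_variation circle_borel \<kappa>) unit_circle
      - measure (upper_variation circle_borel (\<lambda>A. - \<kappa> A)) unit_circle"
    by (rule Jordan_decomposition[OF \<kappa> unit_circle_sets])
  then show ?thesis
    by (simp add: potential_def signed_integral_def right_diff_distrib
        pos.integral_circle_dist_uminus[OF assms] neg.integral_circle_dist_uminus[OF assms])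
qed

lemma potential_Lipschitz:
  "\<bar>potential \<kappa> (circle_param s) - potential \<kappa> (circle_param t)\<bar>
    \<le> total_variation circle_borel \<kappa> unit_circle * \<bar>s - t\<bar>"
  using pos.integral_circle_dist_Lipschitz[of s t] neg.integral_circle_dist_Lipschitz[of s t]
  by (simp add: potential_def signed_integral_def total_variation_def distrib_right abs_le_iff)

lemma arc_complement: "\<kappa> (circle_arc (a - pi) a) = \<kappa> unit_circle - \<kappa> (circle_arc a (a + pi))"
  using sigma_additive_Un[OF \<kappa> arc_sets arc_sets half_circles(2)[of a]]
  unfolding half_circles(1) by simp

lemma potential_left_derivative:
  "((\<lambda>t. (potential \<kappa> (circle_param (a + t)) - potential \<kappa> (circle_param a)) / t)
     \<longlongrightarrow> \<kappa> unit_circle - 2 * \<kappa> (circle_arc a (a + pi))) (at_left 0)"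
proof -
  let ?m = "\<lambda>\<nu>. measure (upper_variation circle_borel \<nu>)"
  let ?I = "\<lambda>\<nu> t. LINT y|upper_variation circle_borel \<nu>. circle_dist (circle_param t) y"
  have lim: "((\<lambda>t. (?I \<kappa> (a + t) - ?I \<kappa> a) / t - (?I (\<lambda>A. - \<kappa> A) (a + t) - ?I (\<lambda>A. - \<kappa> A) a) / t)
     \<longlongrightarrow> (?m \<kappa> (circle_arc (a - pi) a) - ?m \<kappa> (circle_arc a (a + pi)))
        - (?m (\<lambda>A. - \<kappa> A) (circle_arc (a - pi) a) - ?m (\<lambda>A. - \<kappa> A) (circle_arc a (a + pi)))) (at_left 0)"
    by (intro tendsto_diff pos.integral_circle_dist_left_derivative neg.integral_circle_dist_left_derivative)
  have "\<kappa> unit_circle - 2 * \<kappa> (circle_arc a (a + pi)) = \<kappa> (circle_arc (a - pi) a) - \<kappa> (circle_arc a (a + pi))"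
    by (simp add: arc_complement)
  also have "\<dots> = (?m \<kappa> (circle_arc (a - pi) a) - ?m \<kappa> (circle_arc a (a + pi)))
        - (?m (\<lambda>A. - \<kappa> A) (circle_arc (a - pi) a) - ?m (\<lambda>A. - \<kappa> A) (circle_arc a (a + pi)))"
    using Jordan_decomposition[OF \<kappa> arc_sets, of "a - pi" a] Jordan_decomposition[OF \<kappa> arc_sets, of a "a + pi"]
    by linarith
  finally have val: "\<kappa> unit_circle - 2 * \<kappa> (circle_arc a (a + pi)) = \<dots>" .
  have quot: "(potential \<kappa> (circle_param (a + t)) - potential \<kappa> (circle_param a)) / t
      = (?I \<kappa> (a + t) - ?I \<kappa> a) / t - (?I (\<lambda>A. - \<kappa> A) (a + t) - ?I (\<lambda>A. - \<kappa> A) a) / t" for t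
    by (simp add: potential_def signed_integral_def diff_divide_distrib)
  show ?thesis unfolding val quot by (rule lim)
qed

text \<open>
  The half circles starting at \<open>s\<close> and \<open>t\<close> differ at most by the arcs \<open>[s, t)\<close> and \<open>[s + \<pi>, t + \<pi>)\<close>, also
  when \<open>t - s\<close> exceeds \<open>\<pi>\<close>.
\<close>

lemma half_circle_variation:
  assumes "s \<le> t"
  shows "\<bar>\<kappa> (circle_arc s (s + pi)) - \<kappa> (circle_arc t (t + pi))\<bar>
    \<le> total_variation circle_borel \<kappa> (circle_arc s t) + total_variation circle_borel \<kappa> (circle_arc (s + pi) (t + pi))"
proof -
  have "circle_arc s (s + pi) - circle_arc t (t + pi) \<subseteq> circle_arc s t"
  proof
    fix y assume y: "y \<in> circle_arc s (s + pi) - circle_arc t (t + pi)"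
    then obtain b where b: "y = circle_param b" "s \<le> b" "b < s + pi" by (auto simp: circle_arc_def)
    then have "\<not> (t \<le> b \<and> b < t + pi)" using y by (auto simp: circle_arc_def)
    then show "y \<in> circle_arc s t" using b assms by (auto simp: circle_arc_def)
  qed
  moreover have "circle_arc t (t + pi) - circle_arc s (s + pi) \<subseteq> circle_arc (s + pi) (t + pi)"
  proof
    fix y assume y: "y \<in> circle_arc t (t + pi) - circle_arc s (s + pi)"
    then obtain b where b: "y = circle_param b" "t \<le> b" "b < t + pi" by (auto simp: circle_arc_def)
    then have "\<not> (s \<le> b \<and> b < s + pi)" using y by (auto simp: circle_arc_def)
    then show "y \<in> circle_arc (s + pi) (t + pi)" using b assms by (auto simp: circle_arc_def)
  qed
  ultimately have
    "total_variation circle_borel \<kappa> (circle_arc s (s + pi) - circle_arc t (t + pi)) \<le> total_variation circle_borel \<kappa> (circle_arc s t)"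
    "total_variation circle_borel \<kappa> (circle_arc t (t + pi) - circle_arc s (s + pi)) \<le> total_variation circle_borel \<kappa> (circle_arc (s + pi) (t + pi))"
    by (intro total_variation_mono[OF \<kappa>]; simp add: sets.Diff)+
  then show ?thesis
    using abs_diff_le_total_variation[OF \<kappa>, of "circle_arc s (s + pi)" "circle_arc t (t + pi)"] by simp
qed

lemma sum_total_variation_arcs:
  assumes "\<And>i. i < n \<Longrightarrow> t i \<le> t (Suc i)" "t n \<le> t 0 + 2 * pi"
  shows "(\<Sum>i<n. total_variation circle_borel \<kappa> (circle_arc (t i + c) (t (Suc i) + c))) \<le> total_variation circle_borel \<kappa> unit_circle"
proof -
  have "t 0 \<le> t m \<and> (\<Sum>i<m. total_variation circle_borel \<kappa> (circle_arc (t i + c) (t (Suc i) + c)))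
      = total_variation circle_borel \<kappa> (circle_arc (t 0 + c) (t m + c))" if "m \<le> n" for m
    using that
  proof (induction m)
    case 0
    show ?case by (simp add: total_variation_def)
  next
    case (Suc m)
    have tmn: "t (Suc m) \<le> t n"
      using Suc.prems by (intro inc_induct[of "Suc m" n "\<lambda>k. t k \<le> t n"]) (use assms(1) order_trans in blast)+
    have le: "t 0 \<le> t m" "t m \<le> t (Suc m)" using Suc assms(1)[of m] by auto
    have "total_variation circle_borel \<kappa> (circle_arc (t 0 + c) (t m + c)) + total_variation circle_borel \<kappa> (circle_arc (t m + c) (t (Suc m) + c))
        = total_variation circle_borel \<kappa> (circle_arc (t 0 + c) (t m + c) \<union> circle_arc (t m + c) (t (Suc m) + c))"
      using le tmn assms(2) by (intro total_variation_Un[OF \<kappa>, symmetric] arc_disjoint) auto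
    also have "circle_arc (t 0 + c) (t m + c) \<union> circle_arc (t m + c) (t (Suc m) + c) = circle_arc (t 0 + c) (t (Suc m) + c)"
      using le by (intro arc_Un) auto
    finally show ?case using Suc le by simp
  qed
  moreover have "total_variation circle_borel \<kappa> (circle_arc (t 0 + c) (t n + c)) \<le> total_variation circle_borel \<kappa> unit_circle"
    by (intro total_variation_mono[OF \<kappa>] arc_subset) simp_all
  ultimately show ?thesis by simp
qed

end

lemma left_derivative_eqI:
  assumes "((\<lambda>t. (f (circle_param (a + t)) - f (circle_param a)) / t) \<longlongrightarrow> D) (at_left 0)"
  shows "left_derivative f (circle_param a) = D"
  unfolding left_derivative_def circle_shift_param using assms by (intro tendsto_Lim) auto

text \<open>
  The arcs between consecutive points of a partition are disjoint, and so are their antipodes, so that each of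
  the two families contributes at most the total variation of \<open>\<kappa>\<close>.
\<close>

lemma circle_total_variation_finite:
  assumes \<kappa>: "sigma_additive circle_borel \<kappa>"
    and g: "\<And>a. g (circle_param a) = c - 2 * \<kappa> (circle_arc a (a + pi))"
  shows "circle_total_variation g < \<infinity>"
proof -
  let ?W = "total_variation circle_borel \<kappa>"
  have "(\<Sum>i=0..n. \<bar>g (circle_param (t i)) - g (circle_param (t (Suc i)))\<bar>) \<le> 4 * ?W unit_circle"
    if t: "t 0 = 0" "t (Suc n) = 2 * pi" "\<forall>i\<le>n. t i \<le> t (Suc i)" for n and t :: "nat \<Rightarrow> real"
  proof -
    have "(\<Sum>i=0..n. \<bar>g (circle_param (t i)) - g (circle_param (t (Suc i)))\<bar>)
        \<le> (\<Sum>i<Suc n. 2 * (?W (circle_arc (t i + 0) (t (Suc i) + 0)) + ?W (circle_arc (t i + pi) (t (Suc i) + pi))))"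
      unfolding atLeast0AtMost lessThan_Suc_atMost
    proof (intro sum_mono)
      fix i assume "i \<in> {..n}"
      then have "t i \<le> t (Suc i)" using t(3) by simp
      from half_circle_variation[OF \<kappa> this]
      show "\<bar>g (circle_param (t i)) - g (circle_param (t (Suc i)))\<bar>
         \<le> 2 * (?W (circle_arc (t i + 0) (t (Suc i) + 0)) + ?W (circle_arc (t i + pi) (t (Suc i) + pi)))"
        by (simp add: g)
    qed
    also have "\<dots> = 2 * ((\<Sum>i<Suc n. ?W (circle_arc (t i + 0) (t (Suc i) + 0))) + (\<Sum>i<Suc n. ?W (circle_arc (t i + pi) (t (Suc i) + pi))))"
      by (simp only: sum_distrib_left[symmetric] sum.distrib)
    also have "\<dots> \<le> 2 * (?W unit_circle + ?W unit_circle)"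
      using t by (intro mult_left_mono add_mono sum_total_variation_arcs[OF \<kappa>]) auto
    finally show ?thesis by simp
  qed
  then have "circle_total_variation g \<le> ennreal (4 * ?W unit_circle)"
    unfolding circle_total_variation_def by (intro SUP_least) (auto intro!: ennreal_leI)
  then show ?thesis by (simp add: le_less_trans[OF _ ennreal_less_top])
qed

lemma potential_regularity:
  assumes \<kappa>: "sigma_additive circle_borel \<kappa>"
    and f: "\<And>x. x \<in> unit_circle \<Longrightarrow> f x = potential \<kappa> x"
  shows "circle_lipschitz f" "left_differentiable f"
    "left_derivative f (circle_param a) = \<kappa> unit_circle - 2 * \<kappa> (circle_arc a (a + pi))"
    "circle_total_variation (left_derivative f) < \<infinity>"
proof -
  have lim: "((\<lambda>t. (f (circle_param (a + t)) - f (circle_param a)) / t)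
      \<longlongrightarrow> \<kappa> unit_circle - 2 * \<kappa> (circle_arc a (a + pi))) (at_left 0)" for a
    using potential_left_derivative[OF \<kappa>, of a] by (simp add: f)
  have ld: "left_derivative f (circle_param a) = \<kappa> unit_circle - 2 * \<kappa> (circle_arc a (a + pi))" for a
    by (rule left_derivative_eqI[OF lim])
  show "left_derivative f (circle_param a) = \<kappa> unit_circle - 2 * \<kappa> (circle_arc a (a + pi))" by (rule ld)
  show "circle_total_variation (left_derivative f) < \<infinity>"
    by (rule circle_total_variation_finite[OF \<kappa> ld])
  show "left_differentiable f"
    unfolding left_differentiable_def
  proof
    fix x assume "x \<in> unit_circle"
    then obtain a where "x = circle_param a" using circle_param_surj_Ico by blast
    then show "\<exists>D. ((\<lambda>t. (f (circle_shift x t) - f x) / t) \<longlongrightarrow> D) (at_left 0)"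
      using lim[of a] by (auto simp: circle_shift_param)
  qed
  show "circle_lipschitz f"
    unfolding circle_lipschitz_def
  proof (intro exI conjI ballI)
    show "0 \<le> total_variation circle_borel \<kappa> unit_circle" by (rule total_variation_nonneg)
    fix x y assume xy: "x \<in> unit_circle" "y \<in> unit_circle"
    obtain s t where st: "x = circle_param s" "y = circle_param t" "\<bar>s - t\<bar> = circle_dist x y"
      by (rule circle_dist_attained[OF xy]) (rule that)
    have "\<bar>f x - f y\<bar> \<le> total_variation circle_borel \<kappa> unit_circle * \<bar>s - t\<bar>"
      unfolding f[OF xy(1)] f[OF xy(2)] unfolding st(1,2) by (rule potential_Lipschitz[OF \<kappa>])
    then show "\<bar>f x - f y\<bar> \<le> total_variation circle_borel \<kappa> unit_circle * circle_dist x y"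
      unfolding st(3) .
  qed
qed

section \<open>Left derivatives on the line\<close>

text \<open>
  Mean value inequality. If \<open>g t - (M + e) * t\<close> grew from \<open>a\<close> to \<open>u\<close>, it would attain its maximum on
  \<open>[a, u]\<close> at a point \<open>c > a\<close>; but its left derivative at \<open>c\<close> is negative, so that it is larger just before
  \<open>c\<close>. The derivative bound is assumed on the open interval only; the end \<open>b\<close> is reached by continuity. This is
  what makes the comparison with a left limit at \<open>b\<close> possible.
\<close>

lemma increment_le_of_left_derivative_le:
  fixes g :: "real \<Rightarrow> real"
  assumes "a \<le> b" and cont: "continuous_on {a..b} g"
    and der: "\<And>t. \<lbrakk>a < t; t < b\<rbrakk> \<Longrightarrow> \<exists>D\<le>M. ((\<lambda>s. (g (t + s) - g t) / s) \<longlongrightarrow> D) (at_left 0)"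
  shows "g b - g a \<le> M * (b - a)"
proof -
  have closed: "g u - g a \<le> (M + e) * (u - a)" if u: "a \<le> u" "u < b" and "0 < e" for u e
  proof (rule ccontr)
    assume neg: "\<not> ?thesis"
    define \<phi> where "\<phi> t = g t - (M + e) * t" for t
    have "continuous_on {a..u} \<phi>"
      unfolding \<phi>_def using u by (intro continuous_intros continuous_on_subset[OF cont]) auto
    then obtain c where c: "c \<in> {a..u}" "\<And>t. t \<in> {a..u} \<Longrightarrow> \<phi> t \<le> \<phi> c"
      using continuous_attains_sup[of "{a..u}" \<phi>] u by auto
    have "\<phi> a < \<phi> u" using neg by (simp add: \<phi>_def algebra_simps)
    moreover have "\<phi> u \<le> \<phi> c" using c(2)[of u] u by simp
    ultimately have "c \<noteq> a" by auto
    then have "a < c" "c < b" using c(1) u by auto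
    then obtain D where D: "D \<le> M" "((\<lambda>s. (g (c + s) - g c) / s) \<longlongrightarrow> D) (at_left 0)"
      using der by blast
    have "eventually (\<lambda>s. (g (c + s) - g c) / s < M + e) (at_left 0)"
      using D(1) \<open>0 < e\<close> by (intro order_tendstoD(2)[OF D(2)]) simp
    moreover have "eventually (\<lambda>s. a - c < s \<and> s < 0) (at_left (0::real))"
      unfolding eventually_at_left_field using \<open>a < c\<close> by (intro exI[of _ "a - c"]) auto
    ultimately have "eventually (\<lambda>s. (g (c + s) - g c) / s < M + e \<and> a - c < s \<and> s < 0) (at_left 0)"
      by (rule eventually_conj)
    then obtain s where s: "(g (c + s) - g c) / s < M + e" "a - c < s" "s < 0"
      using eventually_happens[of _ "at_left (0::real)"] by auto
    then have "(M + e) * s < g (c + s) - g c" by (simp add: neg_divide_less_eq)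
    then have "\<phi> c < \<phi> (c + s)" by (simp add: \<phi>_def distrib_left)
    moreover have "\<phi> (c + s) \<le> \<phi> c" using c s by (intro c(2)) auto
    ultimately show False by simp
  qed
  have inner: "g u - g a \<le> M * (u - a)" if "a \<le> u" "u < b" for u
  proof (rule field_le_epsilon)
    fix e :: real assume "0 < e"
    have "(M + e / (u - a + 1)) * (u - a) \<le> M * (u - a) + e"
    proof -
      have "e * (u - a) \<le> e * (u - a + 1)" using \<open>0 < e\<close> by (intro mult_left_mono) auto
      then show ?thesis using that(1) by (simp add: distrib_right pos_divide_le_eq)
    qed
    then show "g u - g a \<le> M * (u - a) + e"
      using closed[OF that, of "e / (u - a + 1)"] \<open>0 < e\<close> that by auto
  qed
  show ?thesis
  proof (cases "a = b")
    case False
    then have "a < b" using \<open>a \<le> b\<close> by simp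
    have "((\<lambda>u. g u) \<longlongrightarrow> g b) (at b within {a..b})"
      using cont \<open>a \<le> b\<close> by (auto simp: continuous_on)
    then have "((\<lambda>u. g u) \<longlongrightarrow> g b) (at_left b)"
      using \<open>a < b\<close> by (simp add: at_within_Icc_at_left)
    then have "((\<lambda>u. g u - g a) \<longlongrightarrow> g b - g a) (at_left b)" by (intro tendsto_intros)
    moreover have "((\<lambda>u. M * (u - a)) \<longlongrightarrow> M * (b - a)) (at_left b)" by (intro tendsto_intros)
    moreover have "eventually (\<lambda>u. g u - g a \<le> M * (u - a)) (at_left b)"
      unfolding eventually_at_left_field using inner \<open>a < b\<close> by (intro exI[of _ a]) auto
    ultimately show ?thesis by (intro tendsto_le[of "at_left b"]) auto
  qed simp
qed

lemma increment_ge_of_left_derivative_ge: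
  fixes g :: "real \<Rightarrow> real"
  assumes "a \<le> b" and cont: "continuous_on {a..b} g"
    and der: "\<And>t. \<lbrakk>a < t; t < b\<rbrakk> \<Longrightarrow> \<exists>D\<ge>m. ((\<lambda>s. (g (t + s) - g t) / s) \<longlongrightarrow> D) (at_left 0)"
  shows "m * (b - a) \<le> g b - g a"
proof -
  have "\<exists>D\<le>- m. ((\<lambda>s. (- g (t + s) - - g t) / s) \<longlongrightarrow> D) (at_left 0)" if "a < t" "t < b" for t
  proof -
    obtain D where D: "m \<le> D" "((\<lambda>s. (g (t + s) - g t) / s) \<longlongrightarrow> D) (at_left 0)" using der \<open>a < t\<close> \<open>t < b\<close> by blast
    have "(- g (t + s) - - g t) / s = - ((g (t + s) - g t) / s)" for s
      by (simp add: diff_divide_distrib)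
    then show ?thesis using tendsto_minus[OF D(2)] D(1) by (intro exI[of _ "- D"]) simp
  qed
  then have "- g b - - g a \<le> - m * (b - a)"
    by (intro increment_le_of_left_derivative_le[OF \<open>a \<le> b\<close>] continuous_on_minus[OF cont]) auto
  then show ?thesis by simp
qed

lemma constant_of_left_derivative_zero:
  fixes g :: "real \<Rightarrow> real"
  assumes cont: "continuous_on UNIV g"
    and der: "\<And>t. ((\<lambda>s. (g (t + s) - g t) / s) \<longlongrightarrow> 0) (at_left 0)"
  shows "g a = g b"
proof -
  have "g y = g x" if "x \<le> y" for x y
    using increment_le_of_left_derivative_le[OF that continuous_on_subset[OF cont], of 0]
      increment_ge_of_left_derivative_ge[OF that continuous_on_subset[OF cont], of 0] der
    by fastforce
  then show ?thesis by (metis linear)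
qed

text \<open>
  Close to \<open>t\<close> and before it, \<open>h\<close> lies within \<open>e\<close> of \<open>L\<close>; by the mean value inequalities so do the difference
  quotients of \<open>g\<close> at \<open>t\<close>, whatever the value of \<open>h\<close> at \<open>t\<close>.
\<close>

lemma left_derivative_eq_left_limit:
  fixes g h :: "real \<Rightarrow> real"
  assumes cont: "continuous_on UNIV g"
    and der: "\<And>t. ((\<lambda>s. (g (t + s) - g t) / s) \<longlongrightarrow> h t) (at_left 0)"
    and lim: "(h \<longlongrightarrow> L) (at_left t)"
  shows "h t = L"
proof -
  have "((\<lambda>s. (g (t + s) - g t) / s) \<longlongrightarrow> L) (at_left 0)"
  proof (rule tendstoI)
    fix e :: real assume "0 < e"
    then have "eventually (\<lambda>u. dist (h u) L < e / 2) (at_left t)" by (intro tendstoD[OF lim]) simp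
    then obtain r where r: "r < t" "\<And>u. \<lbrakk>r < u; u < t\<rbrakk> \<Longrightarrow> dist (h u) L < e / 2"
      unfolding eventually_at_left_field by blast
    have "dist ((g (t + s) - g t) / s) L < e" if s: "r - t < s" "s < 0" for s
    proof -
      have near: "h u \<le> L + e / 2" "L - e / 2 \<le> h u" if "t + s < u" "u < t" for u
        using r(2)[of u] that s unfolding dist_real_def by linarith+
      have "g t - g (t + s) \<le> (L + e / 2) * (t - (t + s))"
      proof (rule increment_le_of_left_derivative_le)
        show "\<exists>D\<le>L + e / 2. ((\<lambda>s. (g (u + s) - g u) / s) \<longlongrightarrow> D) (at_left 0)" if "t + s < u" "u < t" for u
          using near[OF that] der[of u] by blast
      qed (use s cont continuous_on_subset in auto)
      moreover have "(L - e / 2) * (t - (t + s)) \<le> g t - g (t + s)"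
      proof (rule increment_ge_of_left_derivative_ge)
        show "\<exists>D\<ge>L - e / 2. ((\<lambda>s. (g (u + s) - g u) / s) \<longlongrightarrow> D) (at_left 0)" if "t + s < u" "u < t" for u
          using near[OF that] der[of u] by blast
      qed (use s cont continuous_on_subset in auto)
      ultimately have "(g (t + s) - g t) / s \<le> L + e / 2" "L - e / 2 \<le> (g (t + s) - g t) / s"
        using s by (simp_all add: neg_divide_le_eq neg_le_divide_eq)
      then show ?thesis using \<open>0 < e\<close> by (simp add: dist_real_def abs_less_iff)
    qed
    then show "eventually (\<lambda>s. dist ((g (t + s) - g t) / s) L < e) (at_left 0)"
      unfolding eventually_at_left_field using r(1) by (intro exI[of _ "r - t"]) auto
  qed
  then show ?thesis using der tendsto_unique trivial_limit_at_left_real by blast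
qed

section \<open>Bounded variation and Stieltjes measures\<close>

definition variation_sums :: "(real \<Rightarrow> real) \<Rightarrow> real \<Rightarrow> real \<Rightarrow> real set" where
  "variation_sums h a b = {\<Sum>i=0..n. \<bar>h (\<tau> i) - h (\<tau> (Suc i))\<bar> | n \<tau>.
     \<tau> 0 = a \<and> \<tau> (Suc n) = b \<and> (\<forall>i\<le>n. \<tau> i \<le> \<tau> (Suc i))}"

lemma variation_sums_extend:
  assumes "x \<in> variation_sums h a s" "s \<le> t"
  shows "x + \<bar>h s - h t\<bar> \<in> variation_sums h a t"
proof -
  obtain n \<tau> where x: "x = (\<Sum>i=0..n. \<bar>h (\<tau> i) - h (\<tau> (Suc i))\<bar>)"
    and \<tau>: "\<tau> 0 = a" "\<tau> (Suc n) = s" "\<forall>i\<le>n. \<tau> i \<le> \<tau> (Suc i)"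
    using assms(1) unfolding variation_sums_def by blast
  \<comment> \<open>The partition is prolonged by the point \<open>t\<close>.\<close>
  define \<sigma> where "\<sigma> i = (if i \<le> Suc n then \<tau> i else t)" for i
  have "(\<Sum>i=0..Suc n. \<bar>h (\<sigma> i) - h (\<sigma> (Suc i))\<bar>) = x + \<bar>h s - h t\<bar>"
    by (simp add: x \<sigma>_def \<tau>(2))
  moreover have "\<sigma> 0 = a" "\<sigma> (Suc (Suc n)) = t" "\<forall>i\<le>Suc n. \<sigma> i \<le> \<sigma> (Suc i)"
    using \<tau> assms(2) by (auto simp: \<sigma>_def le_Suc_eq)
  ultimately show ?thesis unfolding variation_sums_def
    by (intro CollectI exI[of _ "Suc n"] exI[of _ \<sigma>] conjI) (simp_all only:)
qed

text \<open>
  \<open>V t\<close> is the variation of \<open>h\<close> on \<open>[a, t]\<close>. Thus \<open>V\<close> and \<open>V - h\<close> are monotone.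
\<close>

lemma Jordan_variation_function:
  assumes bdd: "\<And>x. x \<in> variation_sums h a b \<Longrightarrow> x \<le> K"
  shows "\<exists>V. \<forall>s t. a \<le> s \<longrightarrow> s \<le> t \<longrightarrow> t \<le> b \<longrightarrow> \<bar>h t - h s\<bar> \<le> V t - V s"
proof (intro exI allI impI)
  fix s t assume st: "a \<le> s" "s \<le> t" "t \<le> b"
  have "0 + \<bar>h a - h s\<bar> \<in> variation_sums h a s"
    using st(1) unfolding variation_sums_def
    by (intro CollectI exI[of _ 0] exI[of _ "\<lambda>i::nat. if i = 0 then a else s"]) auto
  then have ne: "variation_sums h a s \<noteq> {}" by blast
  have "bdd_above (variation_sums h a t)"
  proof (rule bdd_aboveI[of _ K])
    fix x assume "x \<in> variation_sums h a t"
    from bdd[OF variation_sums_extend[OF this st(3)]] show "x \<le> K" by simp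
  qed
  then have "x + \<bar>h s - h t\<bar> \<le> Sup (variation_sums h a t)" if "x \<in> variation_sums h a s" for x
    using variation_sums_extend[OF that st(2)] by (intro cSup_upper)
  then have "Sup (variation_sums h a s) \<le> Sup (variation_sums h a t) - \<bar>h s - h t\<bar>"
    by (intro cSup_least[OF ne]) (simp add: le_diff_eq)
  then show "\<bar>h t - h s\<bar> \<le> Sup (variation_sums h a t) - Sup (variation_sums h a s)"
    by (simp add: abs_minus_commute)
qed

text \<open>
  The left limit of a monotone function. Passing from \<open>P\<close> to \<open>left_limit P\<close> makes both parts of a monotone
  decomposition left-continuous; if the difference is left-continuous, it does not change.
\<close>

definition left_limit :: "(real \<Rightarrow> real) \<Rightarrow> real \<Rightarrow> real" where
  "left_limit P t = Sup (P ` {..<t})"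

context
  fixes P :: "real \<Rightarrow> real"
  assumes P: "mono P"
begin

lemma left_limit_upper: "s < t \<Longrightarrow> P s \<le> left_limit P t"
  unfolding left_limit_def using monoD[OF P]
  by (intro cSup_upper bdd_aboveI[of _ "P t"]) auto

lemma left_limit_less_iff: "x < left_limit P t \<longleftrightarrow> (\<exists>s<t. x < P s)"
  unfolding left_limit_def using monoD[OF P]
  by (subst less_cSup_iff) (auto intro!: bdd_aboveI[of _ "P t"])

lemma left_limit_mono: "s \<le> t \<Longrightarrow> left_limit P s \<le> left_limit P t"
  by (rule leI) (metis left_limit_less_iff order_less_le_trans less_irrefl)

lemma tendsto_left_limit: "(P \<longlongrightarrow> left_limit P t) (at_left t)"
proof (rule increasing_tendsto)
  show "eventually (\<lambda>u. P u \<le> left_limit P t) (at_left t)"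
    unfolding eventually_at_left_field by (intro exI[of _ "t - 1"]) (auto intro: left_limit_upper)
  fix x assume "x < left_limit P t"
  then obtain s where "s < t" "x < P s" by (auto simp: left_limit_less_iff)
  then show "eventually (\<lambda>u. x < P u) (at_left t)"
    unfolding eventually_at_left_field using monoD[OF P]
    by (intro exI[of _ s]) (auto intro: less_le_trans)
qed

lemma left_limit_left_continuous: "(left_limit P \<longlongrightarrow> left_limit P t) (at_left t)"
proof (rule increasing_tendsto)
  show "eventually (\<lambda>u. left_limit P u \<le> left_limit P t) (at_left t)"
    unfolding eventually_at_left_field by (intro exI[of _ "t - 1"]) (auto intro: left_limit_mono)
  fix x assume "x < left_limit P t"
  then obtain s where "s < t" "x < P s" by (auto simp: left_limit_less_iff)
  then show "eventually (\<lambda>u. x < left_limit P u) (at_left t)"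
    unfolding eventually_at_left_field by (intro exI[of _ s]) (auto simp: left_limit_less_iff)
qed

text \<open>
  \<^const>\<open>interval_measure\<close> expects a right-continuous function and measures intervals \<open>{a<..b}\<close>; the
  reflection \<open>t \<mapsto> - t\<close> turns this into a left-continuous function and intervals \<open>{a..<b}\<close>.
\<close>

lemma Stieltjes_measure_left_limit:
  "\<exists>\<mu>. sets \<mu> = sets borel \<and> (\<forall>a b. a \<le> b \<longrightarrow> emeasure \<mu> {a..<b} = ennreal (left_limit P b - left_limit P a))"
proof -
  define F where "F t = - left_limit P (- t)" for t
  have F_mono: "F x \<le> F y" if "x \<le> y" for x y
    using left_limit_mono[of "- y" "- x"] that by (simp add: F_def)
  have F_cont: "continuous (at_right a) F" for a
    using left_limit_left_continuous[of "- a"]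
    unfolding continuous_within F_def filterlim_at_left_to_right[of _ _ "- a"]
    by (intro tendsto_minus) simp
  define \<mu> where "\<mu> = distr (interval_measure F) borel (uminus :: real \<Rightarrow> real)"
  have "emeasure \<mu> {a..<b} = ennreal (left_limit P b - left_limit P a)" if "a \<le> b" for a b
  proof -
    have "uminus -` {a..<b} = {- b<..- a}" by auto
    then have "emeasure \<mu> {a..<b} = emeasure (interval_measure F) {- b<..- a}"
      by (simp add: \<mu>_def emeasure_distr)
    also have "\<dots> = ennreal (F (- a) - F (- b))"
      using that by (intro emeasure_interval_measure_Ioc F_mono F_cont) auto
    finally show ?thesis by (simp add: F_def)
  qed
  moreover have "sets \<mu> = sets borel" by (simp add: \<mu>_def)
  ultimately show ?thesis by blast
qed

end

section \<open>Signed measures are determined by arcs\<close>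

text \<open>
  For \<open>a \<le> b \<le> a + \<pi>\<close>, the arc \<open>[a, b + \<pi>)\<close> is both \<open>[a, a + \<pi>) \<union> [a + \<pi>, b + \<pi>)\<close> and
  \<open>[a, b) \<union> [b, b + \<pi>)\<close>. As half circles have mass zero, the arc \<open>[a, b)\<close> and its antipode have equal masses,
  and by antisymmetry opposite ones.
\<close>

lemma antisymmetric_vanishing_on_arcs:
  assumes \<mu>: "sigma_additive circle_borel \<mu>"
    and anti: "\<And>A. A \<in> sets circle_borel \<Longrightarrow> \<mu> (uminus ` A) = - \<mu> A"
    and half: "\<And>t. \<mu> (circle_arc t (t + pi)) = 0"
    and st: "s \<le> t" "t \<le> s + 2 * pi"
  shows "\<mu> (circle_arc s t) = 0"
proof -
  have split: "\<mu> (circle_arc a c) = \<mu> (circle_arc a b) + \<mu> (circle_arc b c)"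
    if "a \<le> b" "b \<le> c" "c \<le> a + 2 * pi" for a b c
    using sigma_additive_Un[OF \<mu> arc_sets arc_sets arc_disjoint[OF that]] arc_Un[OF that(1,2)] by simp
  have short: "\<mu> (circle_arc a b) = 0" if "a \<le> b" "b \<le> a + pi" for a b
  proof -
    have "\<mu> (circle_arc a (b + pi)) = \<mu> (circle_arc a (a + pi)) + \<mu> (circle_arc (a + pi) (b + pi))"
      using that by (intro split) auto
    moreover have "\<mu> (circle_arc a (b + pi)) = \<mu> (circle_arc a b) + \<mu> (circle_arc b (b + pi))"
      using that by (intro split) auto
    moreover have "\<mu> (circle_arc (a + pi) (b + pi)) = - \<mu> (circle_arc a b)"
      using anti[of "circle_arc a b"] by (simp add: arc_uminus)
    ultimately show ?thesis by (simp add: half)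
  qed
  show ?thesis
  proof (cases "t \<le> s + pi")
    case False
    then have "\<mu> (circle_arc s t) = \<mu> (circle_arc s (s + pi)) + \<mu> (circle_arc (s + pi) t)"
      using st by (intro split) auto
    then show ?thesis using False st by (simp add: short)
  qed (use st short in simp)
qed

lemma image_angles: "A \<subseteq> unit_circle \<Longrightarrow> circle_param ` (angles A) = A"
proof (intro equalityI subsetI)
  fix x assume "A \<subseteq> unit_circle" "x \<in> A"
  then obtain t where "0 \<le> t" "t < 0 + 2 * pi" "x = circle_param t"
    using circle_param_surj_Ico[of x 0] by blast
  then show "x \<in> circle_param ` angles A" using \<open>x \<in> A\<close> by (auto simp: angles_def)
qed (auto simp: angles_def)

text \<open>
  Through \<^const>\<open>circle_param\<close> the Borel sets of the circle correspond to those of \<open>[0, 2 * pi)\<close>, and half-open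
  intervals are an intersection-stable generator of the latter. The sets of mass zero form a Dynkin system.
\<close>

lemma sigma_additive_zero_if_zero_on_arcs:
  assumes \<mu>: "sigma_additive circle_borel \<mu>"
    and arcs: "\<And>s t. \<lbrakk>s \<le> t; t \<le> s + 2 * pi\<rbrakk> \<Longrightarrow> \<mu> (circle_arc s t) = 0"
    and A: "A \<in> sets circle_borel"
  shows "\<mu> A = 0"
proof -
  let ?G = "range (\<lambda>(a, b). {a..<b :: real})"
  define q where "q B = circle_param ` (B \<inter> {0..<2 * pi})" for B
  have inj: "inj_on circle_param {0..<2 * pi}" using inj_on_circle_param[of 0] by simp
  have q_UNIV: "q UNIV = unit_circle" using arc_full[of 0] by (simp add: q_def circle_arc_def)
  have "Int_stable ?G"
  proof (rule Int_stableI)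
    fix X Y assume "X \<in> ?G" "Y \<in> ?G"
    then obtain a b c d where "X = {a..<b}" "Y = {c..<d}" by auto
    then have "X \<inter> Y = (\<lambda>(a, b). {a..<b}) (max a c, min b d)" by auto
    then show "X \<inter> Y \<in> ?G" by (rule range_eqI)
  qed
  moreover have "?G \<subseteq> Pow UNIV" by simp
  moreover have "angles A \<in> sigma_sets UNIV ?G"
    using angles_borel[OF A] unfolding borel_eq_atLeastLessThan by (simp add: sets_measure_of)
  ultimately have "q (angles A) \<in> sets circle_borel \<and> \<mu> (q (angles A)) = 0"
  proof (induction rule: sigma_sets_induct_disjoint)
    case (basic B)
    then obtain a b where B: "B = {a..<b}" by auto
    have "q B = circle_arc (max a 0) (min b (2 * pi))"
      unfolding q_def circle_arc_def B by (intro arg_cong[where f = "(`) circle_param"]) auto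
    moreover have "\<mu> (circle_arc (max a 0) (min b (2 * pi))) = 0"
    proof (cases "max a 0 \<le> min b (2 * pi)")
      case True
      then show ?thesis by (intro arcs) auto
    next
      case False
      then have "min b (2 * pi) \<le> max a 0" by linarith
      then show ?thesis using sigma_additive_empty[OF \<mu>] by (simp only: arc_empty)
    qed
    ultimately show ?case by simp
  next
    case empty
    then show ?case using sigma_additive_empty[OF \<mu>] by (simp add: q_def)
  next
    case (compl B)
    have "q (UNIV - B) = q UNIV - q B"
      unfolding q_def using inj by (subst inj_on_image_set_diff[OF inj, symmetric]) (auto intro!: arg_cong[where f = "(`) circle_param"])
    moreover have "\<mu> (unit_circle - q B) = \<mu> unit_circle - \<mu> (q B)"
      using compl.IH by (intro sigma_additive_Diff[OF \<mu>]) (auto simp: q_def)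
    moreover have "\<mu> unit_circle = 0" using arcs[of 0 "2 * pi"] arc_full[of 0] by simp
    ultimately show ?case using compl.IH by (simp add: q_UNIV sets.Diff)
  next
    case (union B)
    have q_Un: "q (\<Union>i. B i) = (\<Union>i. q (B i))" by (auto simp: q_def)
    have "disjoint_family (\<lambda>i. q (B i))"
      unfolding disjoint_family_on_def
    proof (intro ballI impI)
      fix i j :: nat assume "i \<noteq> j"
      then have "B i \<inter> B j = {}" using union.hyps(1) by (simp add: disjoint_family_on_def)
      moreover have "q (B i) \<inter> q (B j) = circle_param ` ((B i \<inter> {0..<2 * pi}) \<inter> (B j \<inter> {0..<2 * pi}))"
        unfolding q_def by (rule inj_on_image_Int[OF inj, symmetric]) auto
      ultimately show "q (B i) \<inter> q (B j) = {}" by (simp add: Int_ac) blast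
    qed
    moreover have "range (\<lambda>i. q (B i)) \<subseteq> sets circle_borel" using union.IH by blast
    ultimately have "(\<lambda>i. \<mu> (q (B i))) sums \<mu> (\<Union>i. q (B i))"
      using sigma_additive_sums[OF \<mu>] by blast
    then have "\<mu> (\<Union>i. q (B i)) = 0" using union.IH by (simp add: sums_0 sums_unique2[OF _ sums_zero])
    moreover have "(\<Union>i. q (B i)) \<in> sets circle_borel" using union.IH by blast
    ultimately show ?case by (simp add: q_Un)
  qed
  moreover have "angles A \<inter> {0..<2 * pi} = angles A" by (auto simp: angles_def)
  then have "q (angles A) = A"
    using image_angles[of A] A by (simp add: q_def sets_circle_borel_iff)
  ultimately show ?thesis by simp
qed

section \<open>Antisymmetric measures with prescribed masses of half circles\<close>

lemma half_circle_Stieltjes_measure: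
  assumes P: "mono P"
  shows "\<exists>m. sigma_additive circle_borel m \<and>
    (\<forall>s t. 0 \<le> s \<longrightarrow> s \<le> t \<longrightarrow> t \<le> pi \<longrightarrow> m (circle_arc s t) = left_limit P t - left_limit P s) \<and>
    (\<forall>A. A \<inter> circle_arc 0 pi = {} \<longrightarrow> m A = 0)"
proof -
  obtain \<mu> where \<mu>: "sets \<mu> = sets borel"
    "\<And>a b. a \<le> b \<Longrightarrow> emeasure \<mu> {a..<b} = ennreal (left_limit P b - left_limit P a)"
    using Stieltjes_measure_left_limit[OF P] by blast
  define N where "N = restrict_space \<mu> {0..<pi}"
  have space_\<mu>: "space \<mu> = UNIV" using sets_eq_imp_space_eq[OF \<mu>(1)] by simp
  have I: "{0..<pi} \<inter> space \<mu> \<in> sets \<mu>" by (simp add: \<mu>(1) space_\<mu>)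
  have space_N: "space N = {0..<pi}" by (simp add: N_def space_restrict_space space_\<mu>)
  have "emeasure N {0..<pi} = ennreal (left_limit P pi - left_limit P 0)"
    by (simp add: N_def emeasure_restrict_space[OF I] \<mu>(2))
  then have "finite_measure N"
    by (intro finite_measureI) (simp add: space_N)
  moreover have "circle_param \<in> measurable N circle_borel"
    unfolding N_def using measurable_circle_param measurable_cong_sets[OF \<mu>(1) refl]
    by (intro measurable_restrict_space1) blast
  ultimately have "sigma_additive circle_borel (\<lambda>A. measure N (circle_param -` A \<inter> space N))"
    by (rule sigma_additive_measure_vimage)
  moreover have "measure N (circle_param -` circle_arc s t \<inter> space N) = left_limit P t - left_limit P s"
    if st: "0 \<le> s" "s \<le> t" "t \<le> pi" for s t
  proof -
    have "circle_param -` circle_arc s t \<inter> space N = {s..<t}"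
    proof (intro equalityI subsetI)
      fix u assume u: "u \<in> circle_param -` circle_arc s t \<inter> space N"
      then obtain v where v: "circle_param u = circle_param v" "s \<le> v" "v < t" by (auto simp: circle_arc_def)
      then have "u = v" using u st by (intro circle_param_eqD) (auto simp: space_N)
      then show "u \<in> {s..<t}" using v by simp
    qed (use st in \<open>auto simp: space_N circle_arc_def\<close>)
    moreover have "emeasure N {s..<t} = ennreal (left_limit P t - left_limit P s)"
      using st by (simp add: N_def emeasure_restrict_space[OF I] \<mu>(2))
    ultimately show ?thesis
      using left_limit_mono[OF P st(2)] by (simp add: measure_def)
  qed
  moreover have "measure N (circle_param -` A \<inter> space N) = 0" if "A \<inter> circle_arc 0 pi = {}" for A
  proof -
    have "circle_param -` A \<inter> space N = {}" using that unfolding space_N circle_arc_def by blast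
    then show ?thesis by simp
  qed
  ultimately show ?thesis by blast
qed

text \<open>
  With \<open>m\<close> the signed Stieltjes measure of \<open>h\<close> on \<open>[0, \<pi>)\<close>, put \<open>\<nu> A = (m A - m (- A)) / 4\<close>. The half circle
  \<open>[t, t + \<pi>)\<close> consists of \<open>[t, \<pi>)\<close> and the antipode of \<open>[0, t)\<close>, so four times its mass is
  \<open>(h \<pi> - h t) - (h t - h 0) = - 2 * h t\<close>.
\<close>

lemma antisymmetric_measure_exists:
  assumes P: "mono P" and Q: "mono Q"
    and h: "\<And>t. \<lbrakk>0 \<le> t; t \<le> pi\<rbrakk> \<Longrightarrow> h t = left_limit P t - left_limit Q t"
    and h_pi: "h pi = - h 0"
  shows "\<exists>\<nu>. sigma_additive circle_borel \<nu> \<and>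
    (\<forall>A\<in>sets circle_borel. \<nu> (uminus ` A) = - \<nu> A) \<and>
    (\<forall>t. 0 \<le> t \<longrightarrow> t \<le> pi \<longrightarrow> \<nu> (circle_arc t (t + pi)) = - h t / 2)"
proof -
  obtain mP where mP: "sigma_additive circle_borel mP"
    "\<And>s t. \<lbrakk>0 \<le> s; s \<le> t; t \<le> pi\<rbrakk> \<Longrightarrow> mP (circle_arc s t) = left_limit P t - left_limit P s"
    "\<And>A. A \<inter> circle_arc 0 pi = {} \<Longrightarrow> mP A = 0"
    using half_circle_Stieltjes_measure[OF P] by blast
  obtain mQ where mQ: "sigma_additive circle_borel mQ"
    "\<And>s t. \<lbrakk>0 \<le> s; s \<le> t; t \<le> pi\<rbrakk> \<Longrightarrow> mQ (circle_arc s t) = left_limit Q t - left_limit Q s"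
    "\<And>A. A \<inter> circle_arc 0 pi = {} \<Longrightarrow> mQ A = 0"
    using half_circle_Stieltjes_measure[OF Q] by blast
  define m where "m A = mP A - mQ A" for A
  have m: "sigma_additive circle_borel m"
    unfolding m_def by (intro sigma_additive_diff mP mQ)
  have m_arc: "m (circle_arc s t) = h t - h s" if "0 \<le> s" "s \<le> t" "t \<le> pi" for s t
    using that by (simp add: m_def mP(2) mQ(2) h)
  have m_zero: "m A = 0" if "A \<inter> circle_arc 0 pi = {}" for A
    using that by (simp add: m_def mP(3) mQ(3))
  define \<nu> where "\<nu> A = (1 / 4) * (m A - m (uminus ` A))" for A
  have "sigma_additive circle_borel (\<lambda>A. m (uminus -` A \<inter> space circle_borel))"
    by (rule sigma_additive_vimage[OF m measurable_uminus_circle])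
  then have "sigma_additive circle_borel (\<lambda>A. m (uminus ` A))"
    by (rule sigma_additive_cong) (simp add: sets_circle_borel_iff uminus_vimage_unit_circle)
  then have \<nu>: "sigma_additive circle_borel \<nu>"
    unfolding \<nu>_def by (intro sigma_additive_cmult sigma_additive_diff m)
  have anti: "\<nu> (uminus ` A) = - \<nu> A" for A
  proof -
    have "uminus ` uminus ` A = A" by (simp add: image_image)
    then show ?thesis unfolding \<nu>_def by (simp only: minus_mult_right minus_diff_eq)
  qed
  have far: "m (circle_arc s t) = 0" if "pi \<le> s" "t \<le> 2 * pi" for s t
  proof (rule m_zero)
    have "circle_arc s t \<subseteq> circle_arc pi (2 * pi)" using that by (auto simp: circle_arc_def)
    then show "circle_arc s t \<inter> circle_arc 0 pi = {}" using arc_disjoint[of 0 pi "2 * pi"] by auto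
  qed
  have near: "\<nu> (circle_arc s t) = (h t - h s) / 4" if "0 \<le> s" "s \<le> t" "t \<le> pi" for s t
    using that m_arc[OF that] far[of "s + pi" "t + pi"] by (simp add: \<nu>_def arc_uminus)
  have "\<nu> (circle_arc t (t + pi)) = - h t / 2" if t: "0 \<le> t" "t \<le> pi" for t
  proof -
    have "\<nu> (circle_arc t pi \<union> circle_arc pi (t + pi)) = \<nu> (circle_arc t pi) + \<nu> (circle_arc pi (t + pi))"
      using t by (intro sigma_additive_Un[OF \<nu>] arc_disjoint) auto
    moreover have "circle_arc t pi \<union> circle_arc pi (t + pi) = circle_arc t (t + pi)"
      using t by (intro arc_Un) auto
    moreover have "\<nu> (circle_arc pi (t + pi)) = - \<nu> (circle_arc 0 t)"
      using anti[of "circle_arc 0 t"] by (simp add: arc_uminus)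
    ultimately show ?thesis using near[of t pi] near[of 0 t] t h_pi by (simp add: field_simps)
  qed
  with \<nu> anti show ?thesis by blast
qed

section \<open>Representation by antisymmetric measures\<close>

lemma half_circle_cong:
  assumes "circle_param s = circle_param t"
  shows "circle_arc s (s + pi) = circle_arc t (t + pi)"
proof -
  have "circle_arc s (s + pi) = circle_shift (circle_param s) ` {0..<pi}" for s
  proof -
    have "{s..<s + pi} = (\<lambda>u. s + u) ` {0..<pi}" by (simp add: add.commute)
    moreover have "circle_shift (circle_param s) = (\<lambda>u. circle_param (s + u))"
      by (intro ext circle_shift_param)
    ultimately show ?thesis unfolding circle_arc_def by (simp only: image_image)
  qed
  then show ?thesis using assms by metis
qed

lemma signed_distr_uminus:
  "A \<in> sets circle_borel \<Longrightarrow> signed_distr circle_borel circle_borel uminus \<nu> A = \<nu> (uminus ` A)"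
  by (simp add: signed_distr_def sets_circle_borel_iff uminus_vimage_unit_circle)

lemma potential_cong:
  assumes "\<And>A. A \<in> sets circle_borel \<Longrightarrow> \<kappa> A = \<kappa>' A"
  shows "potential \<kappa> x = potential \<kappa>' x"
proof -
  have "upper_variation circle_borel \<nu> = upper_variation circle_borel \<nu>'"
    if "\<And>A. A \<in> sets circle_borel \<Longrightarrow> \<nu> A = \<nu>' A" for \<nu> \<nu>'
  proof -
    have "(\<lambda>A. SUP B \<in> {B \<in> sets circle_borel. B \<subseteq> A}. ennreal (\<nu> B))
        = (\<lambda>A. SUP B \<in> {B \<in> sets circle_borel. B \<subseteq> A}. ennreal (\<nu>' B))"
      using that by (intro ext SUP_cong) auto
    then show ?thesis by (simp add: upper_variation_def)
  qed
  from this[of \<kappa> \<kappa>'] this[of "\<lambda>A. - \<kappa> A" "\<lambda>A. - \<kappa>' A"] assms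
  show ?thesis by (simp add: potential_def signed_integral_def)
qed

text \<open>
  An antisymmetric measure has total mass zero, and the uniform measure gives half circles the mass \<open>1 / 2\<close>.
  Thus \<open>\<kappa>(S) = C\<close> and the contributions of \<open>C\<close> to the left derivative cancel.
\<close>

lemma antisymmetric_potential:
  assumes \<nu>: "sigma_additive circle_borel \<nu>"
    and anti: "\<And>A. A \<in> sets circle_borel \<Longrightarrow> \<nu> (uminus ` A) = - \<nu> A"
    and f: "\<And>x. x \<in> unit_circle \<Longrightarrow> f x = potential (\<lambda>A. \<nu> A + C * normalized_hausdorff1 A) x"
  shows "x \<in> unit_circle \<Longrightarrow> f x + f (- x) = pi * C"
    and "circle_lipschitz f" "left_differentiable f"
    and "left_derivative f (circle_param a) = - 2 * \<nu> (circle_arc a (a + pi))"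
    and "circle_total_variation (left_derivative f) < \<infinity>"
proof -
  define \<kappa> where "\<kappa> = (\<lambda>A. \<nu> A + C * normalized_hausdorff1 A)"
  have \<kappa>: "sigma_additive circle_borel \<kappa>"
    unfolding \<kappa>_def by (intro sigma_additive_add sigma_additive_cmult sigma_additive_normalized_hausdorff1 \<nu>)
  note f = f[folded \<kappa>_def]
  have S: "uminus ` unit_circle = unit_circle"
    using uminus_vimage_unit_circle[of unit_circle] uminus_unit_circle by auto
  have "\<nu> unit_circle = 0" using anti[OF unit_circle_sets] by (simp add: S)
  then have total: "\<kappa> unit_circle = C" by (simp add: \<kappa>_def normalized_hausdorff1_unit_circle)
  have half: "normalized_hausdorff1 (circle_arc a (a + pi)) = 1 / 2"
  proof -
    have "circle_arc a (a + pi) = uminus ` circle_arc (a - pi) a" by (simp add: arc_uminus)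
    then have "normalized_hausdorff1 (circle_arc a (a + pi)) = normalized_hausdorff1 (circle_arc (a - pi) a)"
      by (simp add: normalized_hausdorff1_uminus)
    then show ?thesis
      using arc_complement[OF sigma_additive_normalized_hausdorff1, of a]
      by (simp add: normalized_hausdorff1_unit_circle)
  qed
  show "f x + f (- x) = pi * C" if "x \<in> unit_circle"
    using potential_uminus[OF \<kappa> that] total that uminus_unit_circle[OF that] by (simp add: f)
  show "circle_lipschitz f" "left_differentiable f" "circle_total_variation (left_derivative f) < \<infinity>"
    by (rule potential_regularity[OF \<kappa> f]; assumption)+
  show "left_derivative f (circle_param a) = - 2 * \<nu> (circle_arc a (a + pi))"
  proof -
    have "left_derivative f (circle_param a) = \<kappa> unit_circle - 2 * \<kappa> (circle_arc a (a + pi))"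
      by (rule potential_regularity(3)[OF \<kappa> f])
    then show ?thesis by (simp add: total) (simp add: \<kappa>_def half)
  qed
qed

lemma left_differentiableD:
  assumes "left_differentiable f"
  shows "((\<lambda>t. (f (circle_param (a + t)) - f (circle_param a)) / t)
    \<longlongrightarrow> left_derivative f (circle_param a)) (at_left 0)"
proof -
  obtain D where D: "((\<lambda>t. (f (circle_param (a + t)) - f (circle_param a)) / t) \<longlongrightarrow> D) (at_left 0)"
    using assms circle_param_in[of a] unfolding left_differentiable_def circle_shift_param[symmetric] by blast
  then show ?thesis using left_derivative_eqI[OF D] by simp
qed

lemma circle_lipschitz_continuous:
  assumes "circle_lipschitz f" shows "continuous_on UNIV (\<lambda>t. f (circle_param t))"
proof -
  obtain L where L: "0 \<le> L" "\<And>x y. \<lbrakk>x \<in> unit_circle; y \<in> unit_circle\<rbrakk> \<Longrightarrow> \<bar>f x - f y\<bar> \<le> L * circle_dist x y"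
    using assms unfolding circle_lipschitz_def by blast
  have "\<bar>f (circle_param s) - f (circle_param t)\<bar> \<le> L * \<bar>s - t\<bar>" for s t
    using L(2)[of "circle_param s" "circle_param t"] mult_left_mono[OF circle_dist_param_le[of s t] L(1)] by simp
  then have "L-lipschitz_on UNIV (\<lambda>t. f (circle_param t))"
    using L(1) by (intro lipschitz_onI) (simp_all add: dist_real_def)
  then show ?thesis by (rule lipschitz_on_continuous_on)
qed

text \<open>
  The values at antipodal points add up to a constant, so that their difference quotients are opposite.
\<close>

lemma left_derivative_antisymmetric:
  assumes sym: "\<And>x. x \<in> unit_circle \<Longrightarrow> f x + f (- x) = c" and diff: "left_differentiable f"
  shows "left_derivative f (circle_param (a + pi)) = - left_derivative f (circle_param a)"
proof (rule left_derivative_eqI)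
  have reflect: "f (circle_param (s + pi)) = c - f (circle_param s)" for s
    using sym[of "circle_param s"] by simp
  have "(f (circle_param (a + pi + t)) - f (circle_param (a + pi))) / t
      = - ((f (circle_param (a + t)) - f (circle_param a)) / t)" for t
  proof -
    have "f (circle_param (a + pi + t)) = c - f (circle_param (a + t))"
      using reflect[of "a + t"] by (simp only: add_ac)
    then show ?thesis using reflect[of a] by (simp add: diff_divide_distrib)
  qed
  then show "((\<lambda>t. (f (circle_param (a + pi + t)) - f (circle_param (a + pi))) / t)
      \<longlongrightarrow> - left_derivative f (circle_param a)) (at_left 0)"
    using tendsto_minus[OF left_differentiableD[OF diff, of a]] by simp
qed

text \<open>
  The left derivative is a difference of monotone functions \<open>P\<close> and \<open>Q\<close> because of its bounded variation, and
  equals the difference of their left limits by \<open>left_derivative_eq_left_limit\<close>.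
\<close>

lemma left_derivative_eq_left_limits:
  assumes lip: "circle_lipschitz f" and diff: "left_differentiable f"
    and var: "circle_total_variation (left_derivative f) < \<infinity>"
  shows "\<exists>P Q. mono P \<and> mono Q \<and>
    (\<forall>t. 0 \<le> t \<longrightarrow> t \<le> 2 * pi \<longrightarrow> left_derivative f (circle_param t) = left_limit P t - left_limit Q t)"
proof -
  define h where "h t = left_derivative f (circle_param t)" for t
  define K where "K = enn2real (circle_total_variation (left_derivative f))"
  have K: "circle_total_variation (left_derivative f) = ennreal K"
    using var unfolding K_def by (intro ennreal_enn2real[symmetric]) simp
  have "x \<le> K" if x_in: "x \<in> variation_sums h 0 (2 * pi)" for x
  proof -
    obtain n \<tau> where x: "x = (\<Sum>i=0..n. \<bar>h (\<tau> i) - h (\<tau> (Suc i))\<bar>)"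
      and \<tau>: "\<tau> 0 = 0" "\<tau> (Suc n) = 2 * pi" "\<forall>i\<le>n. \<tau> i \<le> \<tau> (Suc i)"
      using x_in unfolding variation_sums_def by blast
    have "ennreal x \<le> circle_total_variation (left_derivative f)"
      unfolding circle_total_variation_def x h_def
      using \<tau> by (intro SUP_upper2[of "(n, \<tau>)"]) auto
    then show ?thesis unfolding K by (simp add: ennreal_le_iff K_def)
  qed
  from Jordan_variation_function[OF this]
  obtain V where V: "\<And>s t. \<lbrakk>0 \<le> s; s \<le> t; t \<le> 2 * pi\<rbrakk> \<Longrightarrow> \<bar>h t - h s\<bar> \<le> V t - V s" by blast
  \<comment> \<open>\<open>V\<close> is controlled on \<open>[0, 2 * pi]\<close> only; \<open>P\<close> and \<open>Q\<close> are constant outside of it.\<close>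
  define c where "c t = max 0 (min t (2 * pi))" for t :: real
  define P where "P t = V (c t)" for t
  define Q where "Q t = V (c t) - h (c t)" for t
  have c: "0 \<le> c t" "c t \<le> 2 * pi" "s \<le> t \<Longrightarrow> c s \<le> c t" for s t by (auto simp: c_def)
  have P: "mono P" using V[OF c(1,3,2)] by (intro monoI) (fastforce simp: P_def)
  have Q: "mono Q" using V[OF c(1,3,2)] by (intro monoI) (fastforce simp: Q_def)
  have "h t = left_limit P t - left_limit Q t" if t: "0 \<le> t" "t \<le> 2 * pi" for t
  proof (cases "t = 0")
    case True
    \<comment> \<open>At \<open>0\<close> the left limits see the constant extension, which has the right value there.\<close>
    have "P ` {..<0} = {P 0}" "Q ` {..<0} = {Q 0}"
      by (auto simp: P_def Q_def c_def image_iff intro!: bexI[of _ "- 1"] lt_ex)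
    then show ?thesis using True by (simp add: left_limit_def) (simp add: P_def Q_def c_def)
  next
    case False
    have "((\<lambda>s. P s - Q s) \<longlongrightarrow> left_limit P t - left_limit Q t) (at_left t)"
      by (intro tendsto_diff tendsto_left_limit P Q)
    moreover have "eventually (\<lambda>s. P s - Q s = h s) (at_left t)"
      unfolding eventually_at_left_field using t False
      by (intro exI[of _ 0]) (auto simp: P_def Q_def c_def)
    ultimately have "(h \<longlongrightarrow> left_limit P t - left_limit Q t) (at_left t)"
      by (simp add: tendsto_cong)
    then show ?thesis
      using left_differentiableD[OF diff, folded h_def]
      by (intro left_derivative_eq_left_limit[where h = h, OF circle_lipschitz_continuous[OF lip]])
  qed
  then show ?thesis using P Q unfolding h_def by blast
qed

text \<open>
  The measure with half circles of mass \<open>- h / 2\<close> has a potential \<open>F\<close> with the left derivative \<open>h\<close> of \<open>f\<close>.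
  So \<open>f - F\<close> is constant, and it changes sign under the antipodal map.
\<close>

lemma representing_measure_exists:
  assumes sym: "\<And>x. x \<in> unit_circle \<Longrightarrow> f x + f (- x) = pi * C"
    and lip: "circle_lipschitz f" and diff: "left_differentiable f"
    and var: "circle_total_variation (left_derivative f) < \<infinity>"
  shows "\<exists>\<nu>. sigma_additive circle_borel \<nu> \<and> (\<forall>A\<in>sets circle_borel. \<nu> (uminus ` A) = - \<nu> A) \<and>
    (\<forall>x\<in>unit_circle. f x = potential (\<lambda>A. \<nu> A + C * normalized_hausdorff1 A) x)"
proof -
  define h where "h t = left_derivative f (circle_param t)" for t
  have h_pi: "h (t + pi) = - h t" for t
    unfolding h_def by (rule left_derivative_antisymmetric[OF sym diff])
  obtain P Q where PQ: "mono P" "mono Q"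
    "\<And>t. \<lbrakk>0 \<le> t; t \<le> 2 * pi\<rbrakk> \<Longrightarrow> h t = left_limit P t - left_limit Q t"
    using left_derivative_eq_left_limits[OF lip diff var] unfolding h_def by blast
  have "\<exists>\<nu>. sigma_additive circle_borel \<nu> \<and>
    (\<forall>A\<in>sets circle_borel. \<nu> (uminus ` A) = - \<nu> A) \<and>
    (\<forall>t. 0 \<le> t \<longrightarrow> t \<le> pi \<longrightarrow> \<nu> (circle_arc t (t + pi)) = - h t / 2)"
    using PQ(3) h_pi[of 0] by (intro antisymmetric_measure_exists[OF PQ(1,2)]) auto
  then obtain \<nu> where \<nu>: "sigma_additive circle_borel \<nu>"
    and anti: "\<And>A. A \<in> sets circle_borel \<Longrightarrow> \<nu> (uminus ` A) = - \<nu> A"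
    and half: "\<And>t. \<lbrakk>0 \<le> t; t \<le> pi\<rbrakk> \<Longrightarrow> \<nu> (circle_arc t (t + pi)) = - h t / 2"
    by blast
  have half': "\<nu> (circle_arc t (t + pi)) = - h t / 2" for t
  proof -
    obtain b where b: "0 \<le> b" "b < 0 + 2 * pi" "circle_param t = circle_param b"
      by (rule circle_param_surj_Ico[OF circle_param_in]) (rule that)
    have "\<nu> (circle_arc b (b + pi)) = - h b / 2"
    proof (cases "b \<le> pi")
      case False
      have "circle_arc b (b + pi) = uminus ` circle_arc (b - pi) b" by (simp add: arc_uminus)
      then show ?thesis using anti[of "circle_arc (b - pi) b"] half[of "b - pi"] h_pi[of "b - pi"] False b by simp
    qed (use b half in simp)
    moreover have "h t = h b" by (simp add: h_def b(3))
    ultimately show ?thesis using half_circle_cong[OF b(3)] by simp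
  qed
  define F where "F = potential (\<lambda>A. \<nu> A + C * normalized_hausdorff1 A)"
  have F_eq: "F x = potential (\<lambda>A. \<nu> A + C * normalized_hausdorff1 A) x" if "x \<in> unit_circle" for x
    by (simp add: F_def)
  note F = antisymmetric_potential[OF \<nu> anti F_eq]
  define D where "D t = f (circle_param t) - F (circle_param t)" for t
  have "((\<lambda>s. (D (t + s) - D t) / s) \<longlongrightarrow> 0) (at_left 0)" for t
  proof -
    have "left_derivative F (circle_param t) = h t" using F(4) half'[of t] by simp
    then have "((\<lambda>s. (f (circle_param (t + s)) - f (circle_param t)) / s
        - (F (circle_param (t + s)) - F (circle_param t)) / s) \<longlongrightarrow> h t - h t) (at_left 0)"
      using left_differentiableD[OF diff, of t] left_differentiableD[OF F(3), of t]
      by (intro tendsto_diff) (simp_all add: h_def)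
    moreover have "(D (t + s) - D t) / s = (f (circle_param (t + s)) - f (circle_param t)) / s
        - (F (circle_param (t + s)) - F (circle_param t)) / s" for s
      by (simp add: D_def diff_divide_distrib)
    ultimately show ?thesis by simp
  qed
  moreover have "continuous_on UNIV D"
    unfolding D_def by (intro continuous_on_diff circle_lipschitz_continuous lip F(2))
  ultimately have const: "D s = D t" for s t
    by (intro constant_of_left_derivative_zero)
  have "D t = 0" for t
  proof -
    have "D (t + pi) = - D t"
      using sym[of "circle_param t"] F(1)[of "circle_param t"] by (simp add: D_def)
    then show ?thesis using const[of "t + pi" t] by simp
  qed
  then have "f x = F x" if "x \<in> unit_circle" for x
    using circle_param_surj_Ico[OF that] unfolding D_def by (metis eq_iff_diff_eq_0)
  then show ?thesis using \<nu> anti unfolding F_def by blast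
qed

text \<open>
  The left derivative of \<open>f\<close> gives the masses of half circles, for both measures.
\<close>

lemma representing_measure_unique:
  assumes \<nu>: "sigma_additive circle_borel \<nu>" and \<mu>: "sigma_additive circle_borel \<mu>"
    and anti: "\<And>A. A \<in> sets circle_borel \<Longrightarrow> \<nu> (uminus ` A) = - \<nu> A"
      "\<And>A. A \<in> sets circle_borel \<Longrightarrow> \<mu> (uminus ` A) = - \<mu> A"
    and f: "\<And>x. x \<in> unit_circle \<Longrightarrow> f x = potential (\<lambda>A. \<nu> A + C * normalized_hausdorff1 A) x"
      "\<And>x. x \<in> unit_circle \<Longrightarrow> f x = potential (\<lambda>A. \<mu> A + C * normalized_hausdorff1 A) x"
    and A: "A \<in> sets circle_borel"
  shows "\<nu> A = \<mu> A"
proof -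
  have half: "\<nu> (circle_arc t (t + pi)) - \<mu> (circle_arc t (t + pi)) = 0" for t
    using antisymmetric_potential(4)[OF \<nu> anti(1) f(1), of t] antisymmetric_potential(4)[OF \<mu> anti(2) f(2), of t]
    by simp
  have d: "sigma_additive circle_borel (\<lambda>A. \<nu> A - \<mu> A)" by (intro sigma_additive_diff \<nu> \<mu>)
  have "\<nu> A - \<mu> A = 0"
    by (rule sigma_additive_zero_if_zero_on_arcs[OF d antisymmetric_vanishing_on_arcs[OF d _ half] A])
      (simp_all add: anti)
  then show ?thesis by simp
qed

theorem theorem1p4:
  fixes f :: "real \<times> real \<Rightarrow> real" and C :: real
  shows "((\<forall>x\<in>unit_circle. f x + f (- x) = pi * C) \<and>
          (circle_lipschitz f \<and> left_differentiable f \<and>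
           circle_total_variation (left_derivative f) < \<infinity>))
     \<longleftrightarrow> (\<exists>!\<nu> :: (real \<times> real) set \<Rightarrow> real.
            signed_measure circle_borel \<nu> \<and>
            (\<forall>A\<in>sets circle_borel. signed_distr circle_borel circle_borel uminus \<nu> A = - \<nu> A) \<and>
            (\<forall>x\<in>unit_circle.
               f x = signed_integral circle_borel
                       (\<lambda>A. \<nu> A + C * normalized_hausdorff1 A) (circle_dist x)))"
    (is "?AB \<longleftrightarrow> (\<exists>!\<nu>. ?rep \<nu>)")
proof -
  have rep_iff: "?rep \<nu> \<longleftrightarrow> \<nu> \<in> sets circle_borel \<rightarrow>\<^sub>E UNIV \<and> sigma_additive circle_borel \<nu> \<and>
      (\<forall>A\<in>sets circle_borel. \<nu> (uminus ` A) = - \<nu> A) \<and>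
      (\<forall>x\<in>unit_circle. f x = potential (\<lambda>A. \<nu> A + C * normalized_hausdorff1 A) x)" for \<nu>
    by (simp add: signed_measure_iff signed_distr_uminus potential_def)
  have unique: "\<nu> = \<mu>" if "?rep \<nu>" "?rep \<mu>" for \<nu> \<mu>
  proof (rule PiE_ext)
    show "\<nu> \<in> sets circle_borel \<rightarrow>\<^sub>E UNIV" "\<mu> \<in> sets circle_borel \<rightarrow>\<^sub>E UNIV"
      using that unfolding rep_iff by simp_all
    show "\<nu> A = \<mu> A" if "A \<in> sets circle_borel" for A
      using \<open>?rep \<nu>\<close> \<open>?rep \<mu>\<close> that unfolding rep_iff
      by (intro representing_measure_unique[of \<nu> \<mu> f C]) simp_all
  qed
  show ?thesis
  proof
    assume ?AB
    then obtain \<nu> where \<nu>: "sigma_additive circle_borel \<nu>"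
      "\<forall>A\<in>sets circle_borel. \<nu> (uminus ` A) = - \<nu> A"
      "\<forall>x\<in>unit_circle. f x = potential (\<lambda>A. \<nu> A + C * normalized_hausdorff1 A) x"
      using representing_measure_exists[of f C] by blast
    define \<nu>' where "\<nu>' = restrict \<nu> (sets circle_borel)"
    have eq: "\<nu>' A = \<nu> A" if "A \<in> sets circle_borel" for A using that by (simp add: \<nu>'_def)
    have "potential (\<lambda>A. \<nu>' A + C * normalized_hausdorff1 A) = potential (\<lambda>A. \<nu> A + C * normalized_hausdorff1 A)"
      by (intro ext potential_cong) (simp add: eq)
    moreover have "sigma_additive circle_borel \<nu>'" by (rule sigma_additive_cong[OF \<nu>(1) eq])
    moreover have "\<nu>' \<in> sets circle_borel \<rightarrow>\<^sub>E UNIV" by (simp add: \<nu>'_def)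
    ultimately have "?rep \<nu>'"
      unfolding rep_iff using \<nu>(2,3) by (simp add: eq uminus_sets_circle)
    then show "\<exists>!\<nu>. ?rep \<nu>" using unique by blast
  next
    assume "\<exists>!\<nu>. ?rep \<nu>"
    then obtain \<nu> where "?rep \<nu>" by blast
    then have \<nu>: "sigma_additive circle_borel \<nu>"
      "\<And>A. A \<in> sets circle_borel \<Longrightarrow> \<nu> (uminus ` A) = - \<nu> A"
      "\<And>x. x \<in> unit_circle \<Longrightarrow> f x = potential (\<lambda>A. \<nu> A + C * normalized_hausdorff1 A) x"
      unfolding rep_iff by simp_all
    show ?AB using antisymmetric_potential[OF \<nu>] by blast
  qed
qed

end
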